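(* Let $z_0=\begin{pmatrix}u_0\\ \rho_0\end{pmatrix}\in H^s\times H^{s-1}$, $s>\frac52$, and let $T$ be the maximal existence time of the solution $z=\begin{pmatrix}u\\ \rho\end{pmatrix}$ to the two-component b-family equation with initial data $z_0$. If $1<k_1\le3$, $k_2\ge0$, $u_0$ is odd, $\rho_0$ is even, $\rho_0(0)=0$, and $u_0'(0)=0$, then $T$ is finite.
   Context: All function spaces are over $\mathbb{R}$; $H^r=H^r(\mathbb{R})$. The real constants $k_1,k_2,k_3$ are given, for some $b\in\mathbb{R}$, by one of two cases: (i) $k_1=b,\ k_2=2b,\ k_3=1$; or (ii) $k_1=b+1,\ k_2=2,\ k_3=b$. The two-component b-family equation is $$m_t=um_x+k_1u_xm+k_2\rho\rho_x,\qquad \rho_t=k_3(u\rho)_x,\qquad m=u-u_{xx},\quad t>0,\ x\in\mathbb{R},$$ with $u(0,\cdot)=u_0$, $\rho(0,\cdot)=\rho_0$; it is understood in the equivalent form $$u_t-uu_x=\partial_x(1-\partial_x^2)^{-1}\left(\tfrac{k_1}{2}u^2+\tfrac{3-k_1}{2}u_x^2+\tfrac{k_2}{2}\rho^2\right),\qquad \rho_t-k_3u\rho_x=k_3u_x\rho.$$ For $z_0\in H^s\times H^{s-1}$, $s\ge2$, there is a unique maximal solution $z\in C([0,T);H^s\times H^{s-1})\cap C^1([0,T);H^{s-1}\times H^{s-2})$; $T$ is its maximal existence time.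
   Formalization: The initial data z_0 is additionally assumed not to be identically zero, because for z_0 = 0 all stated hypotheses hold while the solution z = 0 is global, so T is infinite. *)

theory Defs
  imports "HOL-Analysis.Analysis"
begin

definition square_integrable :: "(real \<Rightarrow> 'a::euclidean_space) \<Rightarrow> bool" where
  "square_integrable f \<longleftrightarrow>
     f \<in> borel_measurable lborel \<and> integrable lborel (\<lambda>x. (norm (f x))\<^sup>2)"

definition truncated_fourier :: "(real \<Rightarrow> real) \<Rightarrow> nat \<Rightarrow> real \<Rightarrow> complex" where
  "truncated_fourier f n \<xi> =
     (LINT x:{- real n..real n}|lborel. complex_of_real (f x) * cis (- (x * \<xi>)))"

text \<open>
  The Fourier transform of a square integrable function is the limit in the mean of the
  transforms of its truncations. It always exists (Plancherel), and it is unique up to null sets.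
\<close>

definition L2_fourier :: "(real \<Rightarrow> real) \<Rightarrow> (real \<Rightarrow> complex) \<Rightarrow> bool" where
  "L2_fourier f g \<longleftrightarrow> square_integrable f \<and> square_integrable g \<and>
     (\<lambda>n. \<integral>\<^sup>+\<xi>. ennreal ((norm (truncated_fourier f n \<xi> - g \<xi>))\<^sup>2) \<partial>lborel) \<longlonglongrightarrow> 0"

text \<open>
  The real space \<open>H\<^sup>r\<close> for \<open>r \<ge> 0\<close>. Its elements are represented by functions,
  so that functions which agree almost everywhere represent the same element.
\<close>

definition sobolev :: "real \<Rightarrow> (real \<Rightarrow> real) set" where
  "sobolev r = {f. \<exists>g. L2_fourier f g \<and>
     integrable lborel (\<lambda>\<xi>. (1 + \<xi>\<^sup>2) powr r * (norm (g \<xi>))\<^sup>2)}"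

text \<open>
  The choice of the transform is immaterial, as any two differ on a null set only. No factor
  \<open>1 / (2 * pi)\<close> is included, so this is the usual norm up to a constant.
\<close>

definition sobolev_norm :: "real \<Rightarrow> (real \<Rightarrow> real) \<Rightarrow> real" where
  "sobolev_norm r f =
     sqrt (LINT \<xi>|lborel. (1 + \<xi>\<^sup>2) powr r * (norm ((SOME g. L2_fourier f g) \<xi>))\<^sup>2)"

definition time_interval :: "ereal \<Rightarrow> real set" where
  "time_interval T = {t. 0 \<le> t \<and> ereal t < T}"

definition sobolev_C0 :: "ereal \<Rightarrow> real \<Rightarrow> (real \<Rightarrow> real \<Rightarrow> real) \<Rightarrow> bool" where
  "sobolev_C0 T r f \<longleftrightarrow>
     (\<forall>t\<in>time_interval T. f t \<in> sobolev r \<and>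
        ((\<lambda>\<tau>. sobolev_norm r (\<lambda>x. f \<tau> x - f t x)) \<longlongrightarrow> 0) (at t within time_interval T))"

text \<open>\<open>f\<close> is in \<open>C\<^sup>1([0,T); H\<^sup>r)\<close> and its derivative is \<open>f'\<close>.\<close>

definition sobolev_C1 ::
  "ereal \<Rightarrow> real \<Rightarrow> (real \<Rightarrow> real \<Rightarrow> real) \<Rightarrow> (real \<Rightarrow> real \<Rightarrow> real) \<Rightarrow> bool" where
  "sobolev_C1 T r f f' \<longleftrightarrow> sobolev_C0 T r f \<and> sobolev_C0 T r f' \<and>
     (\<forall>t\<in>time_interval T.
        ((\<lambda>\<tau>. sobolev_norm r (\<lambda>x. (f \<tau> x - f t x) / (\<tau> - t) - f' t x)) \<longlongrightarrow> 0)
          (at t within time_interval T))"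

text \<open>
  \<open>p = (1 - \<partial>\<^sub>x\<^sup>2)\<^sup>-\<^sup>1 f\<close>, where \<open>1 - \<partial>\<^sub>x\<^sup>2\<close> maps \<open>H\<^sup>r\<^sup>+\<^sup>2\<close> bijectively onto \<open>H\<^sup>r\<close>.
  Both \<open>f\<close> and \<open>p\<close> are continuous representatives; for \<open>r > 1/2\<close> they exist and
  \<open>p\<close> is then twice continuously differentiable.
\<close>

definition inverse_helmholtz :: "real \<Rightarrow> (real \<Rightarrow> real) \<Rightarrow> (real \<Rightarrow> real) \<Rightarrow> bool" where
  "inverse_helmholtz r f p \<longleftrightarrow> p \<in> sobolev (r + 2) \<and> continuous_on UNIV p \<and>
     (\<forall>x. p x - deriv (deriv p) x = f x)"

text \<open>
  Solutions on \<open>[0,T)\<close>, for \<open>s > 5/2\<close>. All spaces that occur have index at least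
  \<open>s - 2 > 1/2\<close>, and every element is given by its continuous representative. In particular
  \<open>u t\<close> is \<open>C\<^sup>2\<close> and \<open>\<rho> t\<close> is \<open>C\<^sup>1\<close>, so that the
  derivatives in \<open>x\<close> are classical ones and the equations hold at every \<open>x\<close>.
  The time derivatives \<open>u'\<close> and \<open>\<rho>'\<close> are those of curves in
  \<open>H\<^sup>s\<^sup>-\<^sup>1\<close> and \<open>H\<^sup>s\<^sup>-\<^sup>2\<close>.
\<close>

definition b_family_solution ::
  "real \<Rightarrow> real \<Rightarrow> real \<Rightarrow> real \<Rightarrow> (real \<Rightarrow> real) \<Rightarrow> (real \<Rightarrow> real) \<Rightarrow> ereal \<Rightarrow>
   (real \<Rightarrow> real \<Rightarrow> real) \<Rightarrow> (real \<Rightarrow> real \<Rightarrow> real) \<Rightarrow> bool" where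
  "b_family_solution k1 k2 k3 s u0 \<rho>0 T u \<rho> \<longleftrightarrow>
     0 < T \<and>
     sobolev_C0 T s u \<and> sobolev_C0 T (s - 1) \<rho> \<and>
     (\<forall>t\<in>time_interval T. continuous_on UNIV (u t) \<and> continuous_on UNIV (\<rho> t)) \<and>
     u 0 = u0 \<and> \<rho> 0 = \<rho>0 \<and>
     (\<exists>u' \<rho>' p.
        sobolev_C1 T (s - 1) u u' \<and> sobolev_C1 T (s - 2) \<rho> \<rho>' \<and>
        (\<forall>t\<in>time_interval T.
           inverse_helmholtz (s - 1)
             (\<lambda>x. k1 / 2 * (u t x)\<^sup>2 + (3 - k1) / 2 * (deriv (u t) x)\<^sup>2 + k2 / 2 * (\<rho> t x)\<^sup>2)
             (p t) \<and>
           (\<forall>x. u' t x - u t x * deriv (u t) x = deriv (p t) x) \<and>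
           (\<forall>x. \<rho>' t x - k3 * u t x * deriv (\<rho> t) x = k3 * deriv (u t) x * \<rho> t x)))"

text \<open>
  \<open>(u, \<rho>)\<close> on \<open>[0,T)\<close> is the solution with no proper extension, that is, \<open>T\<close>
  is its maximal existence time; \<open>T = \<infinity>\<close> for a global solution.
\<close>

definition b_family_maximal_solution ::
  "real \<Rightarrow> real \<Rightarrow> real \<Rightarrow> real \<Rightarrow> (real \<Rightarrow> real) \<Rightarrow> (real \<Rightarrow> real) \<Rightarrow> ereal \<Rightarrow>
   (real \<Rightarrow> real \<Rightarrow> real) \<Rightarrow> (real \<Rightarrow> real \<Rightarrow> real) \<Rightarrow> bool" where
  "b_family_maximal_solution k1 k2 k3 s u0 \<rho>0 T u \<rho> \<longleftrightarrow>
     b_family_solution k1 k2 k3 s u0 \<rho>0 T u \<rho> \<and>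
     (\<nexists>T' v \<eta>. T < T' \<and> b_family_solution k1 k2 k3 s u0 \<rho>0 T' v \<eta> \<and>
        (\<forall>t\<in>time_interval T. v t = u t \<and> \<eta> t = \<rho> t))"

lemma truncated_fourier_zero [simp]: "truncated_fourier (\<lambda>x. 0) n \<xi> = 0"
  by (simp add: truncated_fourier_def)

lemma square_integrable_zero: "square_integrable (\<lambda>x. 0)"
  by (simp add: square_integrable_def)

lemma L2_fourier_zero: "L2_fourier (\<lambda>x. 0) (\<lambda>\<xi>. 0)"
  by (simp add: L2_fourier_def square_integrable_zero)

lemma sobolev_zero: "(\<lambda>x. 0) \<in> sobolev r"
  unfolding sobolev_def using L2_fourier_zero by force

lemma sobolev_norm_zero: "sobolev_norm r (\<lambda>x. 0) = 0"
proof -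
  define g where "g = (SOME g. L2_fourier (\<lambda>x. 0) g)"
  have g: "L2_fourier (\<lambda>x. 0) g"
    unfolding g_def by (rule someI[where P = "L2_fourier (\<lambda>x. 0)", OF L2_fourier_zero])
  then have [measurable]: "g \<in> borel_measurable lborel"
    by (simp add: L2_fourier_def square_integrable_def)
  have "(\<integral>\<^sup>+\<xi>. ennreal ((norm (g \<xi>))\<^sup>2) \<partial>lborel) = 0"
    using g by (simp add: L2_fourier_def LIMSEQ_const_iff)
  then have "AE \<xi> in lborel. ennreal ((norm (g \<xi>))\<^sup>2) = 0"
    by (subst (asm) nn_integral_0_iff_AE) auto
  then have "AE \<xi> in lborel. (1 + \<xi>\<^sup>2) powr r * (norm (g \<xi>))\<^sup>2 = 0"
    by eventually_elim (simp add: ennreal_eq_0_iff)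
  then have "(LINT \<xi>|lborel. (1 + \<xi>\<^sup>2) powr r * (norm (g \<xi>))\<^sup>2) = 0"
    by (rule integral_eq_zero_AE)
  then show ?thesis
    by (simp add: sobolev_norm_def g_def)
qed

text \<open>
  With zero data the solution is global for all parameters, so these data have to be excluded
  from any blow-up statement.
\<close>

lemma b_family_zero_global:
  "b_family_maximal_solution k1 k2 k3 s (\<lambda>x. 0) (\<lambda>x. 0) \<infinity> (\<lambda>t x. 0) (\<lambda>t x. 0)"
proof -
  have C0: "sobolev_C0 T r (\<lambda>t x. 0)" for T r
    by (simp add: sobolev_C0_def sobolev_zero sobolev_norm_zero)
  have C1: "sobolev_C1 T r (\<lambda>t x. 0) (\<lambda>t x. 0)" for T r
    by (simp add: sobolev_C1_def C0 sobolev_norm_zero)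
  have H: "inverse_helmholtz r (\<lambda>x. 0) (\<lambda>x. 0)" for r
    by (simp add: inverse_helmholtz_def sobolev_zero)
  have "b_family_solution k1 k2 k3 s (\<lambda>x. 0) (\<lambda>x. 0) \<infinity> (\<lambda>t x. 0) (\<lambda>t x. 0)"
    unfolding b_family_solution_def
    by (auto simp: C0 H intro!: C1 exI[of _ "\<lambda>t x. 0"])
  then show ?thesis
    by (simp add: b_family_maximal_solution_def)
qed

end

theory Submission
  imports Defs "HOL-Probability.Characteristic_Functions"
begin

text \<open>
  Suppose that the solution were global. The slope \<open>g t = deriv (u t) 0\<close> at the origin then obeys
  a Riccati equation, which has no global solution.

  The initial data have the symmetry \<open>u\<close> odd, \<open>\<rho>\<close> even, and the equations respect it, so by
  uniqueness the solution keeps it. Hence \<open>u t 0 = 0\<close> for all times, and then \<open>\<rho> t 0 = 0\<close> as well,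
  since the second equation at the origin is a linear ordinary differential equation for
  \<open>\<rho> t 0\<close>. With \<open>p = (1 - \<partial>\<^sub>x\<^sup>2)\<^sup>-\<^sup>1 f\<close> for
  \<open>f = k1 / 2 * u\<^sup>2 + (3 - k1) / 2 * u\<^sub>x\<^sup>2 + k2 / 2 * \<rho>\<^sup>2\<close>, the \<open>x\<close>-derivative of the first equation
  at the origin becomes \<open>g' = (k1 - 1) / 2 * g\<^sup>2 + p t 0\<close>. The conditions on the parameters make
  \<open>f\<close> nonnegative, hence also \<open>p\<close>, and nontrivial data give \<open>p 0 0 > 0\<close>. So \<open>g\<close> starts at 0,
  becomes positive, and blows up in finite time (\<open>riccati_blow_up\<close>).

  Uniqueness is proved in the supremum norm (\<open>symmetry_preserved\<close>). The defects
  \<open>u t x + u t (- x)\<close>, its space derivative, and \<open>\<rho> t x - \<rho> t (- x)\<close> vanish at infinity, so the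
  largest of them is attained. There its space derivative is zero, the transport terms drop
  out, and the remaining terms are bounded by the defects; a Gronwall argument for suprema
  (\<open>gronwall_maximum_principle\<close>) shows that the defects stay zero. Bounds for \<open>p\<close> and
  its sign come from the maximum principle for \<open>p - p''\<close> on functions that vanish at infinity,
  the strict positivity at the origin from its strong form (\<open>helmholtz_strong_minimum\<close>).

  These arguments are pointwise. They are linked to the Sobolev spaces by the embedding theorem
  (\<open>sobolev_embedding\<close>): a continuous \<open>f \<in> H\<^sup>r\<close> has classical derivatives of all orders
  \<open>j < r - 1 / 2\<close>, bounded by a multiple of its norm. It rests on the inversion formula for
  the transform in the mean, which follows by testing against modulated Gaussians
  (\<open>L2_fourier_inversion\<close>). The condition \<open>s > 5 / 2\<close> is what makes \<open>u\<^sub>x\<^sub>x\<close> and \<open>\<rho>\<^sub>x\<close> bounded.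
\<close>

section \<open>Fourier inversion by duality with Gaussians\<close>

lemma integrable_mult_of_squares:
  fixes f g :: "'b \<Rightarrow> 'a :: {banach, second_countable_topology, real_normed_algebra}"
  assumes [measurable]: "f \<in> borel_measurable M" "g \<in> borel_measurable M"
    and "integrable M (\<lambda>x. (norm (f x))\<^sup>2)" "integrable M (\<lambda>x. (norm (g x))\<^sup>2)"
  shows "integrable M (\<lambda>x. f x * g x)"
proof (rule Bochner_Integration.integrable_bound)
  show "integrable M (\<lambda>x. (norm (f x))\<^sup>2 + (norm (g x))\<^sup>2)"
    using assms by simp
  show "AE x in M. norm (f x * g x) \<le> norm ((norm (f x))\<^sup>2 + (norm (g x))\<^sup>2)"
  proof (rule AE_I2)
    fix x
    have "norm (f x * g x) \<le> norm (f x) * norm (g x)"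
      by (rule norm_mult_ineq)
    also have "\<dots> \<le> 2 * norm (f x) * norm (g x)" by simp
    also have "\<dots> \<le> (norm (f x))\<^sup>2 + (norm (g x))\<^sup>2"
      by (rule sum_squares_bound)
    finally show "norm (f x * g x) \<le> norm ((norm (f x))\<^sup>2 + (norm (g x))\<^sup>2)"
      by simp
  qed
qed simp

text \<open>
  Stated in the extended nonnegative reals, so that it can be applied to an $L^2$ distance that
  is only known to tend to zero.
\<close>

lemma Cauchy_Schwarz_norm_integral:
  fixes f g :: "'b \<Rightarrow> 'a :: {banach, second_countable_topology, real_normed_algebra}"
  assumes [measurable]: "f \<in> borel_measurable M" "g \<in> borel_measurable M"
  shows "ennreal ((norm (\<integral>x. f x * g x \<partial>M))\<^sup>2)
    \<le> (\<integral>\<^sup>+x. ennreal ((norm (f x))\<^sup>2) \<partial>M) * (\<integral>\<^sup>+x. ennreal ((norm (g x))\<^sup>2) \<partial>M)"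
proof (cases "integrable M (\<lambda>x. f x * g x)")
  case True
  have "ennreal (norm (\<integral>x. f x * g x \<partial>M)) \<le> (\<integral>\<^sup>+x. norm (f x * g x) \<partial>M)"
    by (rule integral_norm_bound_ennreal[OF True])
  also have "\<dots> \<le> (\<integral>\<^sup>+x. ennreal (norm (f x)) * ennreal (norm (g x)) \<partial>M)"
    by (rule nn_integral_mono) (simp add: norm_mult_ineq flip: ennreal_mult)
  finally have "ennreal (norm (\<integral>x. f x * g x \<partial>M)) ^ 2
      \<le> (\<integral>\<^sup>+x. ennreal (norm (f x)) * ennreal (norm (g x)) \<partial>M) ^ 2"
    by (rule power_mono) simp
  also have "\<dots> \<le> (\<integral>\<^sup>+x. (ennreal (norm (f x)))\<^sup>2 \<partial>M) * (\<integral>\<^sup>+x. (ennreal (norm (g x)))\<^sup>2 \<partial>M)"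
    by (rule Cauchy_Schwarz_nn_integral) auto
  finally show ?thesis
    by (simp add: ennreal_power)
next
  case False
  then show ?thesis by (simp add: not_integrable_integral_eq)
qed

definition trig_integral :: "(real \<Rightarrow> complex) \<Rightarrow> real \<Rightarrow> complex" where
  "trig_integral G x = (LINT \<xi>|lborel. G \<xi> * cis (x * \<xi>))"

lemma measurable_cis [measurable]: "cis \<in> borel_measurable borel"
  by (intro borel_measurable_continuous_onI continuous_intros)

lemma measurable_truncated_fourier [measurable]:
  assumes [measurable]: "f \<in> borel_measurable lborel"
  shows "truncated_fourier f n \<in> borel_measurable lborel"
  unfolding truncated_fourier_def set_lebesgue_integral_def by measurable

lemma truncation_integrable:
  assumes "square_integrable (f :: real \<Rightarrow> real)"
  shows "integrable lborel (\<lambda>x. indicator {- real n..real n} x * f x)"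
proof -
  have [measurable]: "f \<in> borel_measurable lborel" and "integrable lborel (\<lambda>x. (norm (f x))\<^sup>2)"
    using assms by (auto simp: square_integrable_def)
  moreover have "integrable lborel (\<lambda>x. (norm (indicator {- real n..real n} x :: real))\<^sup>2)"
  proof -
    have "(\<lambda>x. (norm (indicator {- real n..real n} x :: real))\<^sup>2) = indicator {- real n..real n}"
      by (auto simp: indicator_def)
    then show ?thesis by simp
  qed
  ultimately show ?thesis by (intro integrable_mult_of_squares) auto
qed

text \<open>
  A truncation of a square integrable function is integrable, so Fubini's theorem applies and
  moves the transform from \<open>f\<close> to the test function.
\<close>

lemma truncated_fourier_dual:
  assumes f: "square_integrable f" and p: "integrable lborel (\<phi> :: real \<Rightarrow> complex)"
  shows "(LINT \<xi>|lborel. truncated_fourier f n \<xi> * \<phi> \<xi>) =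
    (LINT y|lborel. indicator {- real n..real n} y * of_real (f y) *
       (LINT \<xi>|lborel. \<phi> \<xi> * cis (- (y * \<xi>))))"
proof -
  have [measurable]: "f \<in> borel_measurable lborel" "\<phi> \<in> borel_measurable lborel"
    using assms by (auto simp: square_integrable_def)
  define h where "h = (\<lambda>y. indicator {- real n..real n} y * f y)"
  have h: "integrable lborel h"
    unfolding h_def by (rule truncation_integrable[OF f])
  have [measurable]: "h \<in> borel_measurable lborel" using h by auto
  have I: "integrable (lborel \<Otimes>\<^sub>M lborel)
      (\<lambda>(y, \<xi>). complex_of_real (h y) * cis (- (y * \<xi>)) * \<phi> \<xi>)"
  proof (rule lborel_pair.Fubini_integrable)
    have "integrable lborel (\<lambda>y. norm (h y) * (LINT \<xi>|lborel. norm (\<phi> \<xi>)))"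
      using h by auto
    then show "integrable lborel (\<lambda>y. LINT \<xi>|lborel. norm (case (y, \<xi>) of (y, \<xi>) \<Rightarrow>
        complex_of_real (h y) * cis (- (y * \<xi>)) * \<phi> \<xi>))"
      by (simp add: norm_mult)
    show "AE y in lborel. integrable lborel (\<lambda>\<xi>. case (y, \<xi>) of (y, \<xi>) \<Rightarrow>
        complex_of_real (h y) * cis (- (y * \<xi>)) * \<phi> \<xi>)"
    proof (rule AE_I2, rule Bochner_Integration.integrable_bound)
      fix y
      show "integrable lborel (\<lambda>\<xi>. norm (h y) * norm (\<phi> \<xi>))"
        using p by auto
    qed (auto simp: norm_mult)
  qed measurable
  have "(LINT \<xi>|lborel. truncated_fourier f n \<xi> * \<phi> \<xi>) =
      (LINT \<xi>|lborel. (LINT y|lborel. complex_of_real (h y) * cis (- (y * \<xi>)) * \<phi> \<xi>))"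
  proof (rule Bochner_Integration.integral_cong)
    fix \<xi>
    have "truncated_fourier f n \<xi> = (LINT y|lborel. complex_of_real (h y) * cis (- (y * \<xi>)))"
      unfolding truncated_fourier_def set_lebesgue_integral_def h_def
      by (intro Bochner_Integration.integral_cong) (auto simp: indicator_def)
    then show "truncated_fourier f n \<xi> * \<phi> \<xi> =
        (LINT y|lborel. complex_of_real (h y) * cis (- (y * \<xi>)) * \<phi> \<xi>)"
      by simp
  qed simp
  also have "\<dots> = (LINT y|lborel. (LINT \<xi>|lborel. complex_of_real (h y) * cis (- (y * \<xi>)) * \<phi> \<xi>))"
    using lborel_pair.Fubini_integral[OF I] by simp
  also have "\<dots> = (LINT y|lborel. indicator {- real n..real n} y * of_real (f y) *
       (LINT \<xi>|lborel. \<phi> \<xi> * cis (- (y * \<xi>))))"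
  proof (rule Bochner_Integration.integral_cong)
    fix y
    have "(LINT \<xi>|lborel. complex_of_real (h y) * cis (- (y * \<xi>)) * \<phi> \<xi>) =
       (LINT \<xi>|lborel. complex_of_real (h y) * (\<phi> \<xi> * cis (- (y * \<xi>))))"
      by (simp add: mult_ac)
    also have "\<dots> = complex_of_real (h y) * (LINT \<xi>|lborel. \<phi> \<xi> * cis (- (y * \<xi>)))"
      by simp
    finally show "(LINT \<xi>|lborel. complex_of_real (h y) * cis (- (y * \<xi>)) * \<phi> \<xi>) =
      indicator {- real n..real n} y * of_real (f y) * (LINT \<xi>|lborel. \<phi> \<xi> * cis (- (y * \<xi>)))"
      by (auto simp: h_def indicator_def)
  qed simp
  finally show ?thesis .
qed

text \<open>
  The duality survives the limit in the mean: on the left, \<open>\<phi>\<close> is square integrable and the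
  truncated transforms converge in $L^2$; on the right, dominated convergence removes the
  truncation. This replaces Plancherel's theorem: testing against Gaussians is all that
  Fourier inversion requires.
\<close>

lemma L2_fourier_dual:
  assumes fg: "L2_fourier f g" and p: "integrable lborel (\<phi> :: real \<Rightarrow> complex)"
    and p2: "integrable lborel (\<lambda>\<xi>. (norm (\<phi> \<xi>))\<^sup>2)"
    and d: "integrable lborel (\<lambda>y. of_real (f y) * (LINT \<xi>|lborel. \<phi> \<xi> * cis (- (y * \<xi>))))"
  shows "(LINT \<xi>|lborel. g \<xi> * \<phi> \<xi>) =
    (LINT y|lborel. of_real (f y) * (LINT \<xi>|lborel. \<phi> \<xi> * cis (- (y * \<xi>))))"
proof (rule LIMSEQ_unique)
  have f: "square_integrable f" and g: "square_integrable g"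
    and lim: "(\<lambda>n. \<integral>\<^sup>+\<xi>. ennreal ((norm (truncated_fourier f n \<xi> - g \<xi>))\<^sup>2) \<partial>lborel) \<longlonglongrightarrow> 0"
    using fg by (auto simp: L2_fourier_def)
  have [measurable]: "f \<in> borel_measurable lborel" "\<phi> \<in> borel_measurable lborel"
    "g \<in> borel_measurable lborel"
    using f g p by (auto simp: square_integrable_def)
  define \<psi> where "\<psi> = (\<lambda>y. LINT \<xi>|lborel. \<phi> \<xi> * cis (- (y * \<xi>)))"
  have [measurable]: "\<psi> \<in> borel_measurable lborel"
    unfolding \<psi>_def by measurable
  have "(\<lambda>n. LINT y|lborel. indicator {- real n..real n} y * of_real (f y) * \<psi> y)
     \<longlonglongrightarrow> (LINT y|lborel. of_real (f y) * \<psi> y)"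
  proof (rule integral_dominated_convergence)
    show "integrable lborel (\<lambda>y. norm (of_real (f y) * \<psi> y))"
      using d unfolding \<psi>_def by (rule integrable_norm)
    show "AE y in lborel. (\<lambda>n. indicator {- real n..real n} y * of_real (f y) * \<psi> y)
        \<longlonglongrightarrow> of_real (f y) * \<psi> y"
    proof (rule AE_I2, rule tendsto_eventually)
      fix y :: real
      obtain N where N: "\<bar>y\<bar> \<le> real N" using real_arch_simple by blast
      show "\<forall>\<^sub>F n in sequentially.
          indicator {- real n..real n} y * of_real (f y) * \<psi> y = of_real (f y) * \<psi> y"
        using eventually_ge_at_top[of N]
        by eventually_elim (use N in \<open>auto simp: indicator_def\<close>)
    qed
  qed (auto simp: indicator_def norm_mult)
  then show "(\<lambda>n. LINT \<xi>|lborel. truncated_fourier f n \<xi> * \<phi> \<xi>)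
     \<longlonglongrightarrow> (LINT y|lborel. of_real (f y) * (LINT \<xi>|lborel. \<phi> \<xi> * cis (- (y * \<xi>))))"
    unfolding truncated_fourier_dual[OF f p] \<psi>_def .
  have g\<phi>: "integrable lborel (\<lambda>\<xi>. g \<xi> * \<phi> \<xi>)"
    using g p2 by (intro integrable_mult_of_squares) (auto simp: square_integrable_def)
  have t\<phi>: "integrable lborel (\<lambda>\<xi>. truncated_fourier f n \<xi> * \<phi> \<xi>)" for n
  proof (rule Bochner_Integration.integrable_bound)
    define M where "M = (LINT x|lborel. norm (indicator {- real n..real n} x * f x))"
    show "integrable lborel (\<lambda>\<xi>. M * norm (\<phi> \<xi>))" using p by auto
    have "norm (truncated_fourier f n \<xi>) \<le> M" for \<xi>
    proof -
      have "norm (truncated_fourier f n \<xi>) \<le>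
        (LINT x|lborel. norm (indicator {- real n..real n} x *\<^sub>R (complex_of_real (f x) * cis (- (x * \<xi>)))))"
        unfolding truncated_fourier_def set_lebesgue_integral_def by (rule integral_norm_bound)
      also have "\<dots> = M" by (simp add: M_def norm_mult abs_mult)
      finally show ?thesis .
    qed
    then have "norm (truncated_fourier f n \<xi> * \<phi> \<xi>) \<le> norm (M * norm (\<phi> \<xi>))" for \<xi>
      unfolding norm_mult by (intro mult_mono) (auto intro: order_trans[OF _ abs_ge_self])
    then show "AE \<xi> in lborel. norm (truncated_fourier f n \<xi> * \<phi> \<xi>) \<le> norm (M * norm (\<phi> \<xi>))"
      by simp
  qed simp
  define e where "e = (\<lambda>n. norm ((LINT \<xi>|lborel. truncated_fourier f n \<xi> * \<phi> \<xi>) -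
      (LINT \<xi>|lborel. g \<xi> * \<phi> \<xi>)))"
  have "(\<lambda>n. ennreal ((e n)\<^sup>2)) \<longlonglongrightarrow> 0"
  proof (rule tendsto_sandwich[OF _ _ tendsto_const])
    show "\<forall>\<^sub>F n in sequentially. ennreal ((e n)\<^sup>2) \<le>
      (\<integral>\<^sup>+\<xi>. ennreal ((norm (truncated_fourier f n \<xi> - g \<xi>))\<^sup>2) \<partial>lborel) *
      (\<integral>\<^sup>+\<xi>. ennreal ((norm (\<phi> \<xi>))\<^sup>2) \<partial>lborel)"
    proof (intro always_eventually allI)
      fix n
      have "e n = norm (LINT \<xi>|lborel. (truncated_fourier f n \<xi> - g \<xi>) * \<phi> \<xi>)"
        unfolding e_def using t\<phi> g\<phi>
        by (subst Bochner_Integration.integral_diff[symmetric]) (auto simp: algebra_simps)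
      then show "ennreal ((e n)\<^sup>2) \<le>
      (\<integral>\<^sup>+\<xi>. ennreal ((norm (truncated_fourier f n \<xi> - g \<xi>))\<^sup>2) \<partial>lborel) *
      (\<integral>\<^sup>+\<xi>. ennreal ((norm (\<phi> \<xi>))\<^sup>2) \<partial>lborel)"
        using Cauchy_Schwarz_norm_integral[of "\<lambda>\<xi>. truncated_fourier f n \<xi> - g \<xi>" lborel \<phi>] by simp
    qed
    have fin: "(\<integral>\<^sup>+\<xi>. ennreal ((norm (\<phi> \<xi>))\<^sup>2) \<partial>lborel) < \<infinity>"
      using p2 by (simp add: integrable_iff_bounded)
    then show "(\<lambda>n. (\<integral>\<^sup>+\<xi>. ennreal ((norm (truncated_fourier f n \<xi> - g \<xi>))\<^sup>2) \<partial>lborel) *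
      (\<integral>\<^sup>+\<xi>. ennreal ((norm (\<phi> \<xi>))\<^sup>2) \<partial>lborel)) \<longlonglongrightarrow> 0"
      using ennreal_tendsto_cmult[OF _ lim, of "\<integral>\<^sup>+\<xi>. ennreal ((norm (\<phi> \<xi>))\<^sup>2) \<partial>lborel"]
      by (simp add: mult.commute)
  qed simp
  then have "(\<lambda>n. (e n)\<^sup>2) \<longlonglongrightarrow> 0"
    by (simp add: ennreal_tendsto_0_iff)
  then have "e \<longlonglongrightarrow> 0"
    using tendsto_real_sqrt[of "\<lambda>n. (e n)\<^sup>2" 0] by (simp add: e_def)
  then show "(\<lambda>n. LINT \<xi>|lborel. truncated_fourier f n \<xi> * \<phi> \<xi>) \<longlonglongrightarrow> (LINT \<xi>|lborel. g \<xi> * \<phi> \<xi>)"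
    unfolding e_def by (subst (asm) tendsto_norm_zero_iff) (rule LIM_zero_cancel)
qed

text \<open>
  This is the characteristic function of the standard normal distribution, rescaled.
\<close>

lemma gaussian_fourier:
  assumes s: "\<sigma> > 0"
  shows "(LINT \<xi>|lborel. (cis (x * \<xi>) * of_real (exp (- (\<xi> / \<sigma>)\<^sup>2 / 2))) * cis (- (y * \<xi>)))
    = of_real (\<sigma> * sqrt (2 * pi) * exp (- ((x - y) * \<sigma>)\<^sup>2 / 2))"
proof -
  have "(LINT z|std_normal_distribution. iexp ((x - y) * \<sigma> * z)) =
      of_real (exp (- ((x - y) * \<sigma>)\<^sup>2 / 2))"
    using fun_cong[OF char_std_normal_distribution, of "(x - y) * \<sigma>"] by (simp add: char_def)
  moreover have "(LINT z|std_normal_distribution. iexp ((x - y) * \<sigma> * z)) =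
      (LINT z|lborel. std_normal_density z *\<^sub>R iexp ((x - y) * \<sigma> * z))"
    by (subst integral_density) auto
  ultimately have *: "(LINT z|lborel. std_normal_density z *\<^sub>R iexp ((x - y) * \<sigma> * z)) =
      of_real (exp (- ((x - y) * \<sigma>)\<^sup>2 / 2))" by simp
  have "(LINT \<xi>|lborel. (cis (x * \<xi>) * of_real (exp (- (\<xi> / \<sigma>)\<^sup>2 / 2))) * cis (- (y * \<xi>)))
     = \<sigma> *\<^sub>R (LINT z|lborel. (cis (x * (\<sigma> * z)) * of_real (exp (- z\<^sup>2 / 2))) * cis (- (y * (\<sigma> * z))))"
    using s by (subst lborel_integral_real_affine[where c = \<sigma> and t = 0]) auto
  also have "\<dots> = \<sigma> *\<^sub>R (LINT z|lborel. sqrt (2 * pi) *\<^sub>R (std_normal_density z *\<^sub>R iexp ((x - y) * \<sigma> * z)))"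
  proof (intro arg_cong[where f = "\<lambda>t. \<sigma> *\<^sub>R t"] Bochner_Integration.integral_cong refl)
    fix z
    have "cis (x * (\<sigma> * z)) * cis (- (y * (\<sigma> * z))) = iexp ((x - y) * \<sigma> * z)"
    proof -
      have "x * (\<sigma> * z) + - (y * (\<sigma> * z)) = (x - y) * \<sigma> * z"
        by (simp add: algebra_simps)
      then show ?thesis
        unfolding cis_mult by (simp only: cis_conv_exp)
    qed
    moreover have "exp (- z\<^sup>2 / 2) = sqrt (2 * pi) * std_normal_density z"
      by (simp add: std_normal_density_def)
    ultimately show "(cis (x * (\<sigma> * z)) * of_real (exp (- z\<^sup>2 / 2))) * cis (- (y * (\<sigma> * z))) =
        sqrt (2 * pi) *\<^sub>R (std_normal_density z *\<^sub>R iexp ((x - y) * \<sigma> * z))"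
      by (simp only: scaleR_conv_of_real of_real_mult) (simp add: mult_ac)
  qed
  also have "\<dots> = of_real (\<sigma> * sqrt (2 * pi) * exp (- ((x - y) * \<sigma>)\<^sup>2 / 2))"
    unfolding integral_scaleR_right * by (simp add: scaleR_conv_of_real)
  finally show ?thesis .
qed

lemma integrable_gaussian:
  fixes a x :: real
  assumes "a > 0"
  shows "integrable lborel (\<lambda>y. exp (- (a * (x - y)\<^sup>2)))"
proof -
  define s where "s = sqrt (1 / (2 * a))"
  have s: "s\<^sup>2 = 1 / (2 * a)" "s > 0" using assms by (auto simp: s_def)
  have "integrable lborel (\<lambda>y. sqrt (2 * pi * s\<^sup>2) * normal_density x s y)"
    using s by auto
  moreover have "sqrt (2 * pi * s\<^sup>2) * normal_density x s y = exp (- (a * (x - y)\<^sup>2))" for y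
    using assms by (simp add: normal_density_def s power2_commute)
  ultimately show ?thesis by simp
qed

lemma integrable_mult_gaussian:
  fixes f :: "real \<Rightarrow> real"
  assumes f: "square_integrable f" and "a > 0"
  shows "integrable lborel (\<lambda>y. f y * exp (- (a * (x - y)\<^sup>2)))"
proof (rule integrable_mult_of_squares)
  have "(norm (exp (- (a * (x - y)\<^sup>2))))\<^sup>2 = exp (- ((2 * a) * (x - y)\<^sup>2))" for y
    by (simp add: exp_double[symmetric] mult_ac)
  then show "integrable lborel (\<lambda>y. (norm (exp (- (a * (x - y)\<^sup>2))))\<^sup>2)"
    using integrable_gaussian[of "2 * a" x] assms by simp
qed (use f in \<open>auto simp: square_integrable_def\<close>)

lemma integrable_mult_gaussian_kernel:
  fixes f :: "real \<Rightarrow> real"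
  assumes f: "square_integrable f" and "\<sigma> > 0"
  shows "integrable lborel (\<lambda>y. f y * (\<sigma> * sqrt (2 * pi) * exp (- ((x - y) * \<sigma>)\<^sup>2 / 2)))"
proof -
  have "integrable lborel (\<lambda>y. (\<sigma> * sqrt (2 * pi)) * (f y * exp (- (\<sigma>\<^sup>2 / 2 * (x - y)\<^sup>2))))"
    using assms by (intro integrable_mult_right integrable_mult_gaussian) auto
  then show ?thesis
    by (rule Bochner_Integration.integrable_cong[THEN iffD1, rotated -1])
      (auto simp: power_mult_distrib mult_ac)
qed

text \<open>
  Away from its centre the Gaussian kernel of width \<open>1 / \<sigma>\<close> is \<open>O(1 / \<sigma>)\<close> times one fixed
  Gaussian. The exponent is split with \<open>d\<^sup>2 + \<sigma>\<^sup>2 \<le> 2 * d\<^sup>2 * \<sigma>\<^sup>2\<close>, and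
  \<open>exp (- \<sigma>\<^sup>2 / 4) \<le> 4 / \<sigma>\<^sup>2\<close> absorbs the normalising factor \<open>\<sigma>\<close>.
\<close>

lemma gaussian_tail_le:
  fixes d \<sigma> :: real
  assumes "1 \<le> \<bar>d\<bar>" "1 \<le> \<sigma>"
  shows "\<sigma> * exp (- (d * \<sigma>)\<^sup>2 / 2) \<le> 4 / \<sigma> * exp (- (1 / 4 * d\<^sup>2))"
proof -
  have d: "1 \<le> d\<^sup>2" using assms by (simp add: abs_le_square_iff[of 1, simplified])
  have s: "1 \<le> \<sigma>\<^sup>2" using assms by simp
  have "0 \<le> (d\<^sup>2 - 1) * (\<sigma>\<^sup>2 - 1)"
    using d s by simp
  then have "d\<^sup>2 + \<sigma>\<^sup>2 \<le> 1 + d\<^sup>2 * \<sigma>\<^sup>2" by (simp add: algebra_simps)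
  moreover have "1 * 1 \<le> d\<^sup>2 * \<sigma>\<^sup>2" using d s by (intro mult_mono) auto
  ultimately have "d\<^sup>2 + \<sigma>\<^sup>2 \<le> 2 * (d * \<sigma>)\<^sup>2" by (simp add: power_mult_distrib)
  then have "exp (- (d * \<sigma>)\<^sup>2 / 2) \<le> exp (- (1 / 4 * d\<^sup>2) + - (\<sigma>\<^sup>2 / 4))"
    by simp
  also have "\<dots> = exp (- (1 / 4 * d\<^sup>2)) * exp (- (\<sigma>\<^sup>2 / 4))" by (rule exp_add)
  also have "\<dots> \<le> exp (- (1 / 4 * d\<^sup>2)) * (4 / \<sigma>\<^sup>2)"
  proof (rule mult_left_mono)
    have "\<sigma>\<^sup>2 / 4 \<le> exp (\<sigma>\<^sup>2 / 4)" using exp_ge_add_one_self[of "\<sigma>\<^sup>2 / 4"] by linarith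
    then show "exp (- (\<sigma>\<^sup>2 / 4)) \<le> 4 / \<sigma>\<^sup>2"
      using assms by (simp add: exp_minus field_simps)
  qed simp
  finally show ?thesis
    using assms by (simp add: field_simps power2_eq_square)
qed

text \<open>
  Since \<open>f\<close> need not be bounded, dominated convergence applies directly only to the part of
  \<open>f\<close> within distance 1 of \<open>x\<close>. The remaining part contributes \<open>O(1 / n)\<close> by the tail bound,
  because \<open>f\<close> is square integrable.
\<close>

lemma gaussian_approximate_identity:
  fixes f :: "real \<Rightarrow> real"
  assumes f: "square_integrable f" and cont: "continuous_on UNIV f"
  shows "(\<lambda>n. LINT y|lborel. f y * (real (Suc n) * sqrt (2 * pi) * exp (- ((x - y) * real (Suc n))\<^sup>2 / 2)))
    \<longlonglongrightarrow> 2 * pi * f x"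
proof -
  have [measurable]: "f \<in> borel_measurable borel"
    using f by (auto simp: square_integrable_def)
  define K where "K = (\<lambda>n y. real (Suc n) * sqrt (2 * pi) * exp (- ((x - y) * real (Suc n))\<^sup>2 / 2))"
  have K0: "K n y \<ge> 0" for n y by (simp add: K_def)
  have fK: "integrable lborel (\<lambda>y. f y * K n y)" for n
    unfolding K_def by (rule integrable_mult_gaussian_kernel[OF f]) simp
  define f1 where "f1 = (\<lambda>y. indicator {x - 1..x + 1} y * f y)"
  define f2 where "f2 = (\<lambda>y. indicator (- {x - 1..x + 1}) y * f y)"
  have [measurable]: "f1 \<in> borel_measurable borel" "f2 \<in> borel_measurable borel"
    by (auto simp: f1_def f2_def)
  have f12: "f y = f1 y + f2 y" for y by (auto simp: f1_def f2_def indicator_def)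
  have f1K: "integrable lborel (\<lambda>y. f1 y * K n y)" and f2K: "integrable lborel (\<lambda>y. f2 y * K n y)" for n
    by (rule Bochner_Integration.integrable_bound[OF fK[of n]];
        auto simp: f1_def f2_def K_def indicator_def abs_mult)+
  have "compact (f ` {x - 1..x + 1})"
    by (intro compact_continuous_image continuous_on_subset[OF cont]) auto
  then obtain M where M: "\<And>y. y \<in> {x - 1..x + 1} \<Longrightarrow> \<bar>f y\<bar> \<le> M"
    by (fastforce dest!: compact_imp_bounded simp: bounded_iff)
  have M1: "\<bar>f1 y\<bar> \<le> \<bar>M\<bar>" for y
    using M[of y] by (auto simp: f1_def indicator_def)
  have "(\<lambda>n. LINT y|lborel. f1 y * K n y) \<longlonglongrightarrow> 2 * pi * f x"
  proof -
    have eq: "(LINT y|lborel. f1 y * K n y) =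
        (LINT z|lborel. f1 (x + z / real (Suc n)) * (2 * pi * std_normal_density z))" for n
    proof -
      have "(LINT y|lborel. f1 y * K n y) = \<bar>1 / real (Suc n)\<bar> *\<^sub>R
         (LINT z|lborel. f1 (x + 1 / real (Suc n) * z) * K n (x + 1 / real (Suc n) * z))"
        by (rule lborel_integral_real_affine) simp
      also have "\<dots> = (LINT z|lborel. \<bar>1 / real (Suc n)\<bar> *\<^sub>R
          (f1 (x + 1 / real (Suc n) * z) * K n (x + 1 / real (Suc n) * z)))"
        by simp
      also have "\<dots> = (LINT z|lborel. f1 (x + z / real (Suc n)) * (2 * pi * std_normal_density z))"
      proof (intro Bochner_Integration.integral_cong refl)
        fix z :: real
        have "2 * pi * std_normal_density z = 2 * pi / sqrt (2 * pi) * exp (- z\<^sup>2 / 2)"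
          by (simp add: std_normal_density_def)
        also have "2 * pi / sqrt (2 * pi) = sqrt (2 * pi)" by (intro real_div_sqrt) simp
        finally have "K n (x + 1 / real (Suc n) * z) = real (Suc n) * (2 * pi * std_normal_density z)"
          by (simp add: K_def)
        then show "\<bar>1 / real (Suc n)\<bar> *\<^sub>R
          (f1 (x + 1 / real (Suc n) * z) * K n (x + 1 / real (Suc n) * z)) =
          f1 (x + z / real (Suc n)) * (2 * pi * std_normal_density z)"
          by simp
      qed
      finally show ?thesis .
    qed
    have "(\<lambda>n. LINT z|lborel. f1 (x + z / real (Suc n)) * (2 * pi * std_normal_density z))
       \<longlonglongrightarrow> (LINT z|lborel. f x * (2 * pi * std_normal_density z))"
    proof (rule integral_dominated_convergence)
      show "integrable lborel (\<lambda>z. \<bar>M\<bar> * (2 * pi * std_normal_density z))"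
        by (intro integrable_mult_right) auto
      show "AE z in lborel. (\<lambda>n. f1 (x + z / real (Suc n)) * (2 * pi * std_normal_density z))
         \<longlonglongrightarrow> f x * (2 * pi * std_normal_density z)"
      proof (intro AE_I2 tendsto_mult tendsto_const)
        fix z :: real
        have z0: "(\<lambda>n. z / real (Suc n)) \<longlonglongrightarrow> 0"
          by (rule LIMSEQ_Suc[OF lim_const_over_n])
        have "(\<lambda>n. f (x + z / real (Suc n))) \<longlonglongrightarrow> f (x + 0)"
          by (rule continuous_on_tendsto_compose[OF cont tendsto_add[OF tendsto_const z0]]) auto
        moreover have "\<forall>\<^sub>F n in sequentially. f (x + z / real (Suc n)) = f1 (x + z / real (Suc n))"
        proof -
          have "\<forall>\<^sub>F n in sequentially. norm (z / real (Suc n)) < 1"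
            by (intro order_tendstoD(2)[OF tendsto_norm_zero[OF z0]]) simp
          then show ?thesis
            by eventually_elim
              (auto simp: f1_def indicator_def abs_less_iff simp del: of_nat_Suc abs_divide)
        qed
        ultimately show "(\<lambda>n. f1 (x + z / real (Suc n))) \<longlonglongrightarrow> f x"
          by (simp add: Lim_transform_eventually)
      qed
      show "AE z in lborel. norm (f1 (x + z / real (Suc n)) * (2 * pi * std_normal_density z))
          \<le> \<bar>M\<bar> * (2 * pi * std_normal_density z)" for n
        using M1 by (auto simp: abs_mult intro!: mult_right_mono)
    qed auto
    then show ?thesis unfolding eq by (simp add: mult_ac)
  qed
  moreover have "(\<lambda>n. LINT y|lborel. f2 y * K n y) \<longlonglongrightarrow> 0"
  proof (rule Lim_null_comparison)
    define Q where "Q = (LINT y|lborel. \<bar>f y * exp (- (1 / 4 * (x - y)\<^sup>2))\<bar>)"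
    have Qi: "integrable lborel (\<lambda>y. \<bar>f y * exp (- (1 / 4 * (x - y)\<^sup>2))\<bar>)"
      using integrable_mult_gaussian[OF f, of "1/4" x] by (intro integrable_abs) simp
    have "norm (LINT y|lborel. f2 y * K n y) \<le> 4 * sqrt (2 * pi) * Q / real (Suc n)" for n
    proof -
      have "norm (LINT y|lborel. f2 y * K n y) \<le>
         (LINT y|lborel. (4 * sqrt (2 * pi) / real (Suc n)) * \<bar>f y * exp (- (1 / 4 * (x - y)\<^sup>2))\<bar>)"
      proof (rule Bochner_Integration.integral_norm_bound_integral[OF f2K])
        show "integrable lborel (\<lambda>y. (4 * sqrt (2 * pi) / real (Suc n)) * \<bar>f y * exp (- (1 / 4 * (x - y)\<^sup>2))\<bar>)"
          by (intro integrable_mult_right) (use Qi in auto)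
        fix y
        show "norm (f2 y * K n y) \<le> (4 * sqrt (2 * pi) / real (Suc n)) * \<bar>f y * exp (- (1 / 4 * (x - y)\<^sup>2))\<bar>"
        proof (cases "y \<in> {x - 1..x + 1}")
          case False
          then have d: "1 \<le> \<bar>x - y\<bar>" by auto
          have "K n y \<le> sqrt (2 * pi) * (4 / real (Suc n) * exp (- (1 / 4 * (x - y)\<^sup>2)))"
            using mult_left_mono[OF gaussian_tail_le[OF d, of "real (Suc n)"], of "sqrt (2 * pi)"]
            by (simp add: K_def mult_ac)
          then have "\<bar>f y\<bar> * K n y \<le> \<bar>f y\<bar> * (sqrt (2 * pi) * (4 / real (Suc n) * exp (- (1 / 4 * (x - y)\<^sup>2))))"
            by (intro mult_left_mono) auto
          then show ?thesis
            using False K0[of n y] by (simp add: f2_def abs_mult mult_ac)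
        qed (simp add: f2_def)
      qed
      also have "\<dots> = 4 * sqrt (2 * pi) * Q / real (Suc n)" by (simp add: Q_def)
      finally show ?thesis .
    qed
    then show "\<forall>\<^sub>F n in sequentially. norm (LINT y|lborel. f2 y * K n y) \<le> 4 * sqrt (2 * pi) * Q / real (Suc n)"
      by simp
    show "(\<lambda>n. 4 * sqrt (2 * pi) * Q / real (Suc n)) \<longlonglongrightarrow> 0"
      by (rule LIMSEQ_Suc[OF lim_const_over_n])
  qed
  ultimately have "(\<lambda>n. (LINT y|lborel. f1 y * K n y) + (LINT y|lborel. f2 y * K n y)) \<longlonglongrightarrow> 2 * pi * f x + 0"
    by (rule tendsto_add)
  moreover have "(LINT y|lborel. f1 y * K n y) + (LINT y|lborel. f2 y * K n y) = (LINT y|lborel. f y * K n y)" for n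
    using f1K f2K by (simp add: f12 distrib_right)
  ultimately show ?thesis by (simp add: K_def)
qed

text \<open>
  Apply the duality to the modulated Gaussians
  \<open>\<phi>\<^sub>n \<xi> = cis (x * \<xi>) * exp (- (\<xi> / n)\<^sup>2 / 2)\<close>. Their transforms are an approximate identity
  at \<open>x\<close>, while \<open>\<phi>\<^sub>n\<close> itself tends to \<open>cis (x * \<xi>)\<close> boundedly.
\<close>

lemma L2_fourier_inversion:
  assumes fg: "L2_fourier f g" and cont: "continuous_on UNIV f" and g: "integrable lborel g"
  shows "trig_integral g x = of_real (2 * pi * f x)"
proof (rule LIMSEQ_unique)
  have f: "square_integrable f" using fg by (simp add: L2_fourier_def)
  have [measurable]: "g \<in> borel_measurable borel" using g by auto
  define \<phi> where "\<phi> = (\<lambda>n \<xi>. cis (x * \<xi>) * complex_of_real (exp (- (\<xi> / real (Suc n))\<^sup>2 / 2)))"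
  have [measurable]: "\<phi> n \<in> borel_measurable borel" for n
    unfolding \<phi>_def by measurable
  have n\<phi>: "norm (\<phi> n \<xi>) = exp (- (1 / (2 * (real (Suc n))\<^sup>2) * (0 - \<xi>)\<^sup>2))" for n \<xi>
    by (simp add: \<phi>_def norm_mult power_divide)
  have i\<phi>: "integrable lborel (\<phi> n)" for n
    by (rule Bochner_Integration.integrable_bound[OF integrable_gaussian[of "1 / (2 * (real (Suc n))\<^sup>2)" 0]])
      (auto simp: n\<phi>)
  have i\<phi>2: "integrable lborel (\<lambda>\<xi>. (norm (\<phi> n \<xi>))\<^sup>2)" for n
  proof -
    have "(norm (\<phi> n \<xi>))\<^sup>2 = exp (- (2 * (1 / (2 * (real (Suc n))\<^sup>2)) * (0 - \<xi>)\<^sup>2))" for \<xi>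
      unfolding n\<phi> by (simp add: exp_double[symmetric])
    then show ?thesis using integrable_gaussian[of "2 * (1 / (2 * (real (Suc n))\<^sup>2))" 0] by simp
  qed
  define K where "K = (\<lambda>n y. real (Suc n) * sqrt (2 * pi) * exp (- ((x - y) * real (Suc n))\<^sup>2 / 2))"
  have \<phi>K: "(LINT \<xi>|lborel. \<phi> n \<xi> * cis (- (y * \<xi>))) = of_real (K n y)" for n y
    unfolding \<phi>_def K_def by (rule gaussian_fourier) simp
  have fK: "integrable lborel (\<lambda>y. complex_of_real (f y) * of_real (K n y))" for n
    using integrable_of_real[OF integrable_mult_gaussian_kernel[OF f, of "real (Suc n)" x]]
    by (simp add: K_def)
  have "(LINT \<xi>|lborel. g \<xi> * \<phi> n \<xi>) = of_real (LINT y|lborel. f y * K n y)" for n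
    using L2_fourier_dual[OF fg i\<phi> i\<phi>2, of n] fK[of n]
    unfolding \<phi>K by (simp flip: of_real_mult)
  then show "(\<lambda>n. LINT \<xi>|lborel. g \<xi> * \<phi> n \<xi>) \<longlonglongrightarrow> of_real (2 * pi * f x)"
    using gaussian_approximate_identity[OF f cont, of x]
    unfolding K_def by (simp only: tendsto_of_real_iff)
  show "(\<lambda>n. LINT \<xi>|lborel. g \<xi> * \<phi> n \<xi>) \<longlonglongrightarrow> trig_integral g x"
    unfolding trig_integral_def
  proof (rule integral_dominated_convergence)
    show "integrable lborel (\<lambda>\<xi>. norm (g \<xi>))" using g by auto
    show "AE \<xi> in lborel. (\<lambda>n. g \<xi> * \<phi> n \<xi>) \<longlonglongrightarrow> g \<xi> * cis (x * \<xi>)"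
    proof (rule AE_I2)
      fix \<xi> :: real
      have "(\<lambda>n. \<xi> / real (Suc n)) \<longlonglongrightarrow> 0"
        by (rule LIMSEQ_Suc[OF lim_const_over_n])
      then have "(\<lambda>n. g \<xi> * \<phi> n \<xi>) \<longlonglongrightarrow> g \<xi> * (cis (x * \<xi>) * complex_of_real (exp (- 0\<^sup>2 / 2)))"
        unfolding \<phi>_def by (intro tendsto_intros) auto
      then show "(\<lambda>n. g \<xi> * \<phi> n \<xi>) \<longlonglongrightarrow> g \<xi> * cis (x * \<xi>)" by simp
    qed
    show "AE \<xi> in lborel. norm (g \<xi> * \<phi> n \<xi>) \<le> norm (g \<xi>)" for n
      by (auto simp: norm_mult n\<phi> intro!: mult_left_le)
  qed auto
qed

section \<open>Sobolev spaces on the line and their embedding into classical derivatives\<close>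

lemma integrable_one_plus_square_powr:
  fixes a :: real
  assumes "a > 1 / 2"
  shows "integrable lborel (\<lambda>\<xi>::real. (1 + \<xi>\<^sup>2) powr (- a))"
proof -
  define h where "h = (\<lambda>\<xi>::real. indicator {1..} \<xi> * \<xi> powr (- (2 * a)))"
  have [measurable]: "h \<in> borel_measurable borel" by (simp add: h_def)
  have "(\<lambda>x::real. x powr (- (2 * a))) integrable_on {1..}"
    using has_integral_powr_to_inf[of "- (2 * a)" 1] assms by (auto simp: integrable_on_def)
  then have "(\<lambda>x::real. x powr (- (2 * a))) absolutely_integrable_on {1..}"
    by (intro nonnegative_absolutely_integrable_1) auto
  then have "integrable lebesgue h"
    by (simp add: set_integrable_def h_def)
  then have h: "integrable lborel h"
    by (subst (asm) integrable_completion) auto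
  have h': "integrable lborel (\<lambda>\<xi>. h (- \<xi>))"
    using lborel_integrable_real_affine[OF h, of "-1" 0] by simp
  have i: "integrable lborel (\<lambda>\<xi>. indicator {- 1..1} \<xi> + h \<xi> + h (- \<xi>))"
    using h h' by (intro Bochner_Integration.integrable_add) auto
  show ?thesis
  proof (rule Bochner_Integration.integrable_bound[OF i])
    have "(1 + \<xi>\<^sup>2) powr (- a) \<le> indicator {- 1..1} \<xi> + h \<xi> + h (- \<xi>)" for \<xi>
    proof (cases "\<bar>\<xi>\<bar> \<le> 1")
      case True
      have "(1 + \<xi>\<^sup>2) powr (- a) \<le> (1 + \<xi>\<^sup>2) powr 0"
        using assms by (intro powr_mono) auto
      also have "\<dots> \<le> 1" by simp
      finally show ?thesis using True by (auto simp: indicator_def h_def)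
    next
      case False
      have "(1 + \<xi>\<^sup>2) powr (- a) \<le> (\<xi>\<^sup>2) powr (- a)"
        using False assms by (intro powr_mono2') auto
      also have "\<dots> = \<bar>\<xi>\<bar> powr (- (2 * a))"
        using powr_powr[of "\<bar>\<xi>\<bar>" 2 "- a"] False by (simp add: powr_numeral)
      also have "\<dots> \<le> indicator {- 1..1} \<xi> + h \<xi> + h (- \<xi>)"
        using False by (auto simp: h_def indicator_def abs_if)
      finally show ?thesis .
    qed
    then show "AE \<xi> in lborel. norm ((1 + \<xi>\<^sup>2) powr (- a)) \<le> norm (indicator {- 1..1} \<xi> + h \<xi> + h (- \<xi>))"
      by (auto intro: order_trans[OF _ abs_ge_self])
  qed simp
qed

lemma norm_add_scaled_square_le:
  fixes a b :: "'a :: real_normed_algebra_1"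
  shows "(norm (a + of_real c * b))\<^sup>2 \<le> 2 * (norm a)\<^sup>2 + 2 * c\<^sup>2 * (norm b)\<^sup>2"
proof -
  have "norm (of_real c * b) \<le> \<bar>c\<bar> * norm b"
    by (rule order_trans[OF norm_mult_ineq]) simp
  then have "(norm (a + of_real c * b))\<^sup>2 \<le> (norm a + \<bar>c\<bar> * norm b)\<^sup>2"
    by (intro power_mono norm_triangle_mono) auto
  also have "\<dots> \<le> 2 * (norm a)\<^sup>2 + 2 * c\<^sup>2 * (norm b)\<^sup>2"
    using sum_squares_bound[of "norm a" "\<bar>c\<bar> * norm b"]
    by (simp add: power2_sum power_mult_distrib)
  finally show ?thesis .
qed

lemma square_integrable_lincomb:
  fixes h1 h2 :: "real \<Rightarrow> 'a :: {euclidean_space, real_normed_algebra_1}"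
  assumes h: "square_integrable h1" "square_integrable h2"
  shows "square_integrable (\<lambda>x. h1 x + of_real c * h2 x)"
proof -
  have [measurable]: "h1 \<in> borel_measurable borel" "h2 \<in> borel_measurable borel"
    using h by (auto simp: square_integrable_def)
  have "integrable lborel (\<lambda>x. (norm (h1 x + of_real c * h2 x))\<^sup>2)"
  proof (rule Bochner_Integration.integrable_bound)
    show "integrable lborel (\<lambda>x. 2 * (norm (h1 x))\<^sup>2 + 2 * c\<^sup>2 * (norm (h2 x))\<^sup>2)"
      using h by (auto simp: square_integrable_def)
    show "AE x in lborel. norm ((norm (h1 x + of_real c * h2 x))\<^sup>2)
        \<le> norm (2 * (norm (h1 x))\<^sup>2 + 2 * c\<^sup>2 * (norm (h2 x))\<^sup>2)"
      using norm_add_scaled_square_le[of "h1 _" c "h2 _"] by simp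
  qed measurable
  then show ?thesis by (simp add: square_integrable_def)
qed

lemma L2_fourier_lincomb:
  assumes "L2_fourier f1 g1" "L2_fourier f2 g2"
  shows "L2_fourier (\<lambda>x. f1 x + c * f2 x) (\<lambda>\<xi>. g1 \<xi> + of_real c * g2 \<xi>)"
proof -
  have f: "square_integrable f1" "square_integrable f2" and g: "square_integrable g1" "square_integrable g2"
    and lim: "(\<lambda>n. \<integral>\<^sup>+\<xi>. ennreal ((norm (truncated_fourier f1 n \<xi> - g1 \<xi>))\<^sup>2) \<partial>lborel) \<longlonglongrightarrow> 0"
      "(\<lambda>n. \<integral>\<^sup>+\<xi>. ennreal ((norm (truncated_fourier f2 n \<xi> - g2 \<xi>))\<^sup>2) \<partial>lborel) \<longlonglongrightarrow> 0"
    using assms by (auto simp: L2_fourier_def)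
  have [measurable]: "f1 \<in> borel_measurable borel" "f2 \<in> borel_measurable borel"
    "g1 \<in> borel_measurable borel" "g2 \<in> borel_measurable borel"
    using f g by (auto simp: square_integrable_def)
  note sq = norm_add_scaled_square_le
  have lin: "truncated_fourier (\<lambda>x. f1 x + c * f2 x) n \<xi> =
      truncated_fourier f1 n \<xi> + of_real c * truncated_fourier f2 n \<xi>" for n \<xi>
  proof -
    have i: "integrable lborel (\<lambda>x. indicator {- real n..real n} x *\<^sub>R (complex_of_real (f x) * cis (- (x * \<xi>))))"
      if "square_integrable f" for f
    proof -
      have [measurable]: "f \<in> borel_measurable borel" using that by (auto simp: square_integrable_def)
      show ?thesis
        by (rule Bochner_Integration.integrable_bound[OF truncation_integrable[OF that, of n]])
          (auto simp: norm_mult abs_mult)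
    qed
    have "truncated_fourier (\<lambda>x. f1 x + c * f2 x) n \<xi> =
      (LINT x|lborel. indicator {- real n..real n} x *\<^sub>R (complex_of_real (f1 x) * cis (- (x * \<xi>))) +
         of_real c * (indicator {- real n..real n} x *\<^sub>R (complex_of_real (f2 x) * cis (- (x * \<xi>)))))"
      unfolding truncated_fourier_def set_lebesgue_integral_def
      by (intro Bochner_Integration.integral_cong) (auto simp: algebra_simps)
    also have "\<dots> = truncated_fourier f1 n \<xi> + of_real c * truncated_fourier f2 n \<xi>"
      unfolding truncated_fourier_def set_lebesgue_integral_def
      by (simp only: Bochner_Integration.integral_add[OF i[OF f(1)] integrable_mult_right[OF i[OF f(2)]]]
          integral_mult_right_zero)
    finally show ?thesis .
  qed
  define E where "E = (\<lambda>f g n. \<integral>\<^sup>+\<xi>. ennreal ((norm (truncated_fourier f n \<xi> - g \<xi>))\<^sup>2) \<partial>lborel)"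
  have "(\<lambda>n. E (\<lambda>x. f1 x + c * f2 x) (\<lambda>\<xi>. g1 \<xi> + of_real c * g2 \<xi>) n) \<longlonglongrightarrow> 0"
  proof (rule tendsto_sandwich[OF _ _ tendsto_const])
    show "\<forall>\<^sub>F n in sequentially. E (\<lambda>x. f1 x + c * f2 x) (\<lambda>\<xi>. g1 \<xi> + of_real c * g2 \<xi>) n
        \<le> 2 * E f1 g1 n + ennreal (2 * c\<^sup>2) * E f2 g2 n"
    proof (intro always_eventually allI)
      fix n
      have "E (\<lambda>x. f1 x + c * f2 x) (\<lambda>\<xi>. g1 \<xi> + of_real c * g2 \<xi>) n \<le>
         (\<integral>\<^sup>+\<xi>. (2 * ennreal ((norm (truncated_fourier f1 n \<xi> - g1 \<xi>))\<^sup>2) +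
            ennreal (2 * c\<^sup>2) * ennreal ((norm (truncated_fourier f2 n \<xi> - g2 \<xi>))\<^sup>2)) \<partial>lborel)"
        unfolding E_def
      proof (rule nn_integral_mono)
        fix \<xi>
        have "truncated_fourier (\<lambda>x. f1 x + c * f2 x) n \<xi> - (g1 \<xi> + of_real c * g2 \<xi>) =
          (truncated_fourier f1 n \<xi> - g1 \<xi>) + of_real c * (truncated_fourier f2 n \<xi> - g2 \<xi>)"
          by (simp add: lin algebra_simps)
        then have "ennreal ((norm (truncated_fourier (\<lambda>x. f1 x + c * f2 x) n \<xi> - (g1 \<xi> + of_real c * g2 \<xi>)))\<^sup>2)
          \<le> ennreal (2 * (norm (truncated_fourier f1 n \<xi> - g1 \<xi>))\<^sup>2 +
             2 * c\<^sup>2 * (norm (truncated_fourier f2 n \<xi> - g2 \<xi>))\<^sup>2)"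
          by (intro ennreal_leI) (simp only: sq)
        also have "\<dots> = 2 * ennreal ((norm (truncated_fourier f1 n \<xi> - g1 \<xi>))\<^sup>2) +
            ennreal (2 * c\<^sup>2) * ennreal ((norm (truncated_fourier f2 n \<xi> - g2 \<xi>))\<^sup>2)"
          by (simp add: ennreal_mult)
        finally show "ennreal ((norm (truncated_fourier (\<lambda>x. f1 x + c * f2 x) n \<xi> - (g1 \<xi> + of_real c * g2 \<xi>)))\<^sup>2)
          \<le> 2 * ennreal ((norm (truncated_fourier f1 n \<xi> - g1 \<xi>))\<^sup>2) +
            ennreal (2 * c\<^sup>2) * ennreal ((norm (truncated_fourier f2 n \<xi> - g2 \<xi>))\<^sup>2)" .
      qed
      also have "\<dots> = 2 * E f1 g1 n + ennreal (2 * c\<^sup>2) * E f2 g2 n"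
        unfolding E_def by (subst nn_integral_add) (auto simp: nn_integral_cmult)
      finally show "E (\<lambda>x. f1 x + c * f2 x) (\<lambda>\<xi>. g1 \<xi> + of_real c * g2 \<xi>) n
        \<le> 2 * E f1 g1 n + ennreal (2 * c\<^sup>2) * E f2 g2 n" .
    qed
    have "(\<lambda>n. 2 * E f1 g1 n + ennreal (2 * c\<^sup>2) * E f2 g2 n) \<longlonglongrightarrow> 2 * 0 + ennreal (2 * c\<^sup>2) * 0"
      using lim unfolding E_def by (intro tendsto_add ennreal_tendsto_cmult) auto
    then show "(\<lambda>n. 2 * E f1 g1 n + ennreal (2 * c\<^sup>2) * E f2 g2 n) \<longlonglongrightarrow> 0" by simp
  qed simp
  moreover have "square_integrable (\<lambda>x. f1 x + c * f2 x)" "square_integrable (\<lambda>\<xi>. g1 \<xi> + of_real c * g2 \<xi>)"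
    using square_integrable_lincomb[OF f] square_integrable_lincomb[OF g] by auto
  ultimately show ?thesis by (simp add: L2_fourier_def E_def)
qed

text \<open>
  By linearity \<open>g - h\<close> is a transform of the zero function, hence at $L^2$ distance 0 from 0.
\<close>

lemma L2_fourier_unique:
  assumes "L2_fourier f g" "L2_fourier f h"
  shows "AE \<xi> in lborel. g \<xi> = h \<xi>"
proof -
  have [measurable]: "g \<in> borel_measurable borel" "h \<in> borel_measurable borel"
    using assms by (auto simp: L2_fourier_def square_integrable_def)
  have "L2_fourier (\<lambda>x. f x + (- 1) * f x) (\<lambda>\<xi>. g \<xi> + of_real (- 1) * h \<xi>)"
    by (rule L2_fourier_lincomb[OF assms])
  then have "(\<integral>\<^sup>+\<xi>. ennreal ((norm (g \<xi> - h \<xi>))\<^sup>2) \<partial>lborel) = 0"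
    by (simp add: L2_fourier_def LIMSEQ_const_iff norm_minus_commute)
  then have "AE \<xi> in lborel. ennreal ((norm (g \<xi> - h \<xi>))\<^sup>2) = 0"
    by (subst (asm) nn_integral_0_iff_AE) auto
  then show ?thesis
    by eventually_elim (simp add: ennreal_eq_0_iff)
qed

lemma sobolev_lincomb:
  assumes "f1 \<in> sobolev r" "f2 \<in> sobolev r"
  shows "(\<lambda>x. f1 x + c * f2 x) \<in> sobolev r"
proof -
  obtain g1 g2 where g: "L2_fourier f1 g1" "L2_fourier f2 g2"
    and i: "integrable lborel (\<lambda>\<xi>. (1 + \<xi>\<^sup>2) powr r * (norm (g1 \<xi>))\<^sup>2)"
      "integrable lborel (\<lambda>\<xi>. (1 + \<xi>\<^sup>2) powr r * (norm (g2 \<xi>))\<^sup>2)"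
    using assms by (auto simp: sobolev_def)
  have [measurable]: "g1 \<in> borel_measurable borel" "g2 \<in> borel_measurable borel"
    using g by (auto simp: L2_fourier_def square_integrable_def)
  have "integrable lborel (\<lambda>\<xi>. (1 + \<xi>\<^sup>2) powr r * (norm (g1 \<xi> + of_real c * g2 \<xi>))\<^sup>2)"
  proof (rule Bochner_Integration.integrable_bound)
    show "integrable lborel (\<lambda>\<xi>. 2 * ((1 + \<xi>\<^sup>2) powr r * (norm (g1 \<xi>))\<^sup>2) +
        2 * c\<^sup>2 * ((1 + \<xi>\<^sup>2) powr r * (norm (g2 \<xi>))\<^sup>2))"
      using i by auto
    have "(1 + \<xi>\<^sup>2) powr r * (norm (g1 \<xi> + of_real c * g2 \<xi>))\<^sup>2 \<le>
       2 * ((1 + \<xi>\<^sup>2) powr r * (norm (g1 \<xi>))\<^sup>2) + 2 * c\<^sup>2 * ((1 + \<xi>\<^sup>2) powr r * (norm (g2 \<xi>))\<^sup>2)" for \<xi>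
    proof -
      show ?thesis
        using mult_left_mono[OF norm_add_scaled_square_le[of "g1 \<xi>" c "g2 \<xi>"], of "(1 + \<xi>\<^sup>2) powr r"]
        by (simp add: algebra_simps)
    qed
    then show "AE \<xi> in lborel. norm ((1 + \<xi>\<^sup>2) powr r * (norm (g1 \<xi> + of_real c * g2 \<xi>))\<^sup>2)
        \<le> norm (2 * ((1 + \<xi>\<^sup>2) powr r * (norm (g1 \<xi>))\<^sup>2) + 2 * c\<^sup>2 * ((1 + \<xi>\<^sup>2) powr r * (norm (g2 \<xi>))\<^sup>2))"
      by (auto intro: order_trans[OF _ abs_ge_self])
  qed measurable
  then show ?thesis
    using L2_fourier_lincomb[OF g, of c] unfolding sobolev_def by blast
qed

text \<open>
  The norm is defined through an arbitrarily chosen transform. That transform agrees almost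
  everywhere with one for which the weighted integral converges, so it can be used instead.
\<close>

lemma sobolev_some_transform:
  assumes "f \<in> sobolev r"
  obtains g where "L2_fourier f g" "integrable lborel (\<lambda>\<xi>. (1 + \<xi>\<^sup>2) powr r * (norm (g \<xi>))\<^sup>2)"
    "sobolev_norm r f = sqrt (LINT \<xi>|lborel. (1 + \<xi>\<^sup>2) powr r * (norm (g \<xi>))\<^sup>2)"
proof -
  obtain h where h: "L2_fourier f h" "integrable lborel (\<lambda>\<xi>. (1 + \<xi>\<^sup>2) powr r * (norm (h \<xi>))\<^sup>2)"
    using assms by (auto simp: sobolev_def)
  define g where "g = (SOME g. L2_fourier f g)"
  have g: "L2_fourier f g" unfolding g_def by (rule someI[where P = "L2_fourier f", OF h(1)])
  have [measurable]: "g \<in> borel_measurable borel" "h \<in> borel_measurable borel"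
    using g h by (auto simp: L2_fourier_def square_integrable_def)
  have "AE \<xi> in lborel. (1 + \<xi>\<^sup>2) powr r * (norm (g \<xi>))\<^sup>2 = (1 + \<xi>\<^sup>2) powr r * (norm (h \<xi>))\<^sup>2"
    using L2_fourier_unique[OF g h(1)] by eventually_elim simp
  then have "integrable lborel (\<lambda>\<xi>. (1 + \<xi>\<^sup>2) powr r * (norm (g \<xi>))\<^sup>2)"
    using h(2) by (subst integrable_cong_AE) auto
  then show ?thesis
    using that[OF g] by (simp add: sobolev_norm_def g_def)
qed

text \<open>
  The constant that Cauchy--Schwarz gives for the sup norm of the \<open>j\<close>-th derivative; the
  divisor \<open>2 * pi\<close> comes from the inversion formula. The integral converges for
  \<open>r > j + 1 / 2\<close>.
\<close>

definition embedding_const :: "nat \<Rightarrow> real \<Rightarrow> real" where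
  "embedding_const j r = sqrt (LINT \<xi>|lborel. \<xi> ^ (2 * j) * (1 + \<xi>\<^sup>2) powr (- r)) / (2 * pi)"

text \<open>
  Cauchy--Schwarz for \<open>\<bar>\<xi>\<bar>\<^sup>j * norm (g \<xi>)\<close>, written as the product of
  \<open>\<bar>\<xi>\<bar>\<^sup>j * (1 + \<xi>\<^sup>2) powr (- r / 2)\<close> and \<open>(1 + \<xi>\<^sup>2) powr (r / 2) * norm (g \<xi>)\<close>.
\<close>

lemma weighted_transform_integrable:
  fixes g :: "real \<Rightarrow> complex"
  assumes [measurable]: "g \<in> borel_measurable borel"
    and g: "integrable lborel (\<lambda>\<xi>. (1 + \<xi>\<^sup>2) powr r * (norm (g \<xi>))\<^sup>2)" and r: "r > real j + 1 / 2"
  shows "integrable lborel (\<lambda>\<xi>. \<bar>\<xi>\<bar> ^ j * norm (g \<xi>))"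
    and "(LINT \<xi>|lborel. \<bar>\<xi>\<bar> ^ j * norm (g \<xi>)) \<le>
      2 * pi * embedding_const j r * sqrt (LINT \<xi>|lborel. (1 + \<xi>\<^sup>2) powr r * (norm (g \<xi>))\<^sup>2)"
proof -
  define a where "a = (\<lambda>\<xi>::real. \<bar>\<xi>\<bar> ^ j * (1 + \<xi>\<^sup>2) powr (- r / 2))"
  define b where "b = (\<lambda>\<xi>::real. (1 + \<xi>\<^sup>2) powr (r / 2) * norm (g \<xi>))"
  have [measurable]: "a \<in> borel_measurable borel" "b \<in> borel_measurable borel"
    by (auto simp: a_def b_def)
  have pos: "1 + \<xi>\<^sup>2 > 0" for \<xi> :: real by (simp add: add_pos_nonneg)
  have a2: "(norm (a \<xi>))\<^sup>2 = \<xi> ^ (2 * j) * (1 + \<xi>\<^sup>2) powr (- r)" for \<xi>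
  proof -
    have "((1 + \<xi>\<^sup>2) powr (- r / 2))\<^sup>2 = (1 + \<xi>\<^sup>2) powr (- r)"
      using pos[of \<xi>] by (simp add: power2_eq_square flip: powr_add)
    moreover have "(\<bar>\<xi>\<bar> ^ j)\<^sup>2 = \<xi> ^ (2 * j)" by (simp add: power_even_abs flip: power_mult mult.commute)
    ultimately show ?thesis by (simp add: a_def power_mult_distrib)
  qed
  have b2: "(norm (b \<xi>))\<^sup>2 = (1 + \<xi>\<^sup>2) powr r * (norm (g \<xi>))\<^sup>2" for \<xi>
  proof -
    have "((1 + \<xi>\<^sup>2) powr (r / 2))\<^sup>2 = (1 + \<xi>\<^sup>2) powr r"
      using pos[of \<xi>] by (simp add: power2_eq_square flip: powr_add)
    then show ?thesis by (simp add: b_def power_mult_distrib)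
  qed
  have ab: "a \<xi> * b \<xi> = \<bar>\<xi>\<bar> ^ j * norm (g \<xi>)" for \<xi>
    using pos[of \<xi>] by (simp add: a_def b_def flip: powr_add)
  have ai: "integrable lborel (\<lambda>\<xi>. (norm (a \<xi>))\<^sup>2)"
  proof (rule Bochner_Integration.integrable_bound[OF integrable_one_plus_square_powr[of "r - real j"]])
    have "\<xi> ^ (2 * j) * (1 + \<xi>\<^sup>2) powr (- r) \<le> (1 + \<xi>\<^sup>2) powr (- (r - real j))" for \<xi> :: real
    proof -
      have "\<xi> ^ (2 * j) \<le> (1 + \<xi>\<^sup>2) ^ j"
        unfolding power_mult by (intro power_mono) auto
      also have "\<dots> = (1 + \<xi>\<^sup>2) powr real j" using pos[of \<xi>] by (simp add: powr_realpow)
      finally have "\<xi> ^ (2 * j) * (1 + \<xi>\<^sup>2) powr (- r) \<le> (1 + \<xi>\<^sup>2) powr real j * (1 + \<xi>\<^sup>2) powr (- r)"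
        by (intro mult_right_mono) auto
      then show ?thesis using pos[of \<xi>] by (simp flip: powr_add)
    qed
    then show "AE \<xi> in lborel. norm ((norm (a \<xi>))\<^sup>2) \<le> norm ((1 + \<xi>\<^sup>2) powr (- (r - real j)))"
      unfolding a2 by (simp add: abs_mult power_even_abs)
  qed (use r in auto)
  have bi: "integrable lborel (\<lambda>\<xi>. (norm (b \<xi>))\<^sup>2)" using g by (simp only: b2)
  show "integrable lborel (\<lambda>\<xi>. \<bar>\<xi>\<bar> ^ j * norm (g \<xi>))"
    using integrable_mult_of_squares[OF _ _ ai bi] by (simp add: ab)
  have "ennreal ((norm (LINT \<xi>|lborel. a \<xi> * b \<xi>))\<^sup>2) \<le>
      ennreal (LINT \<xi>|lborel. (norm (a \<xi>))\<^sup>2) * ennreal (LINT \<xi>|lborel. (norm (b \<xi>))\<^sup>2)"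
  proof -
    have A: "(\<integral>\<^sup>+\<xi>. ennreal ((norm (a \<xi>))\<^sup>2) \<partial>lborel) = ennreal (LINT \<xi>|lborel. (norm (a \<xi>))\<^sup>2)"
      by (rule nn_integral_eq_integral[OF ai]) simp
    have B: "(\<integral>\<^sup>+\<xi>. ennreal ((norm (b \<xi>))\<^sup>2) \<partial>lborel) = ennreal (LINT \<xi>|lborel. (norm (b \<xi>))\<^sup>2)"
      by (rule nn_integral_eq_integral[OF bi]) simp
    show ?thesis
      unfolding A[symmetric] B[symmetric] by (rule Cauchy_Schwarz_norm_integral) measurable
  qed
  then have "(norm (LINT \<xi>|lborel. a \<xi> * b \<xi>))\<^sup>2 \<le>
      (LINT \<xi>|lborel. (norm (a \<xi>))\<^sup>2) * (LINT \<xi>|lborel. (norm (b \<xi>))\<^sup>2)"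
    by (subst (asm) ennreal_mult[symmetric]) (auto intro!: integral_nonneg_AE mult_nonneg_nonneg)
  then have "(LINT \<xi>|lborel. a \<xi> * b \<xi>) \<le>
      sqrt ((LINT \<xi>|lborel. (norm (a \<xi>))\<^sup>2) * (LINT \<xi>|lborel. (norm (b \<xi>))\<^sup>2))"
    by (intro real_le_rsqrt) simp
  then show "(LINT \<xi>|lborel. \<bar>\<xi>\<bar> ^ j * norm (g \<xi>)) \<le>
      2 * pi * embedding_const j r * sqrt (LINT \<xi>|lborel. (1 + \<xi>\<^sup>2) powr r * (norm (g \<xi>))\<^sup>2)"
    unfolding ab a2 b2 by (simp add: embedding_const_def real_sqrt_mult)
qed

lemma DERIV_integral_dominated:
  fixes k k' :: "real \<Rightarrow> 'b \<Rightarrow> real"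
  assumes k: "\<And>x. integrable M (k x)" and [measurable]: "k' x0 \<in> borel_measurable M"
    and d: "\<And>x \<xi>. ((\<lambda>x. k x \<xi>) has_real_derivative k' x \<xi>) (at x)"
    and w: "integrable M w" and b: "\<And>x \<xi>. \<bar>k' x \<xi>\<bar> \<le> w \<xi>"
  shows "((\<lambda>x. integral\<^sup>L M (k x)) has_real_derivative integral\<^sup>L M (k' x0)) (at x0)"
  unfolding DERIV_def tendsto_at_iff_sequentially
proof (intro allI impI)
  fix X :: "nat \<Rightarrow> real" assume X: "\<forall>i. X i \<in> UNIV - {0}" "X \<longlonglongrightarrow> 0"
  have "(\<lambda>i. LINT \<xi>|M. (k (x0 + X i) \<xi> - k x0 \<xi>) / X i) \<longlonglongrightarrow> integral\<^sup>L M (k' x0)"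
  proof (rule integral_dominated_convergence)
    show "AE \<xi> in M. (\<lambda>i. (k (x0 + X i) \<xi> - k x0 \<xi>) / X i) \<longlonglongrightarrow> k' x0 \<xi>"
    proof (rule AE_I2)
      fix \<xi>
      have "((\<lambda>h. (k (x0 + h) \<xi> - k x0 \<xi>) / h) \<longlongrightarrow> k' x0 \<xi>) (at 0)"
        using d[of \<xi> x0] by (simp add: DERIV_def)
      then show "(\<lambda>i. (k (x0 + X i) \<xi> - k x0 \<xi>) / X i) \<longlonglongrightarrow> k' x0 \<xi>"
        using X by (auto simp: tendsto_at_iff_sequentially o_def)
    qed
    show "AE \<xi> in M. norm ((k (x0 + X i) \<xi> - k x0 \<xi>) / X i) \<le> w \<xi>" for i
    proof (rule AE_I2)
      fix \<xi>
      have "norm (k (x0 + X i) \<xi> - k x0 \<xi>) \<le> w \<xi> * norm ((x0 + X i) - x0)"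
        by (rule field_differentiable_bound[of UNIV]) (auto intro: d b)
      then show "norm ((k (x0 + X i) \<xi> - k x0 \<xi>) / X i) \<le> w \<xi>"
        using X(1)[rule_format, of i] by (simp add: field_simps)
    qed
  qed (use k w in \<open>auto intro!: borel_measurable_integrable\<close>)
  moreover have "(LINT \<xi>|M. (k (x0 + X i) \<xi> - k x0 \<xi>) / X i) =
      (integral\<^sup>L M (k (x0 + X i)) - integral\<^sup>L M (k x0)) / X i" for i
    by (simp only: integral_divide_zero Bochner_Integration.integral_diff[OF k k])
  ultimately show "((\<lambda>h. (integral\<^sup>L M (k (x0 + h)) - integral\<^sup>L M (k x0)) / h) \<circ> X) \<longlonglongrightarrow> integral\<^sup>L M (k' x0)"
    by (simp only: o_def)
qed

lemma continuous_integral_dominated: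
  fixes k :: "real \<Rightarrow> 'b \<Rightarrow> real"
  assumes [measurable]: "\<And>x. k x \<in> borel_measurable M"
    and c: "\<And>\<xi>. continuous_on UNIV (\<lambda>x. k x \<xi>)"
    and w: "integrable M w" and b: "\<And>x \<xi>. \<bar>k x \<xi>\<bar> \<le> w \<xi>"
  shows "continuous_on UNIV (\<lambda>x. integral\<^sup>L M (k x))"
  unfolding continuous_on_sequentially o_def
proof (intro allI ballI impI)
  fix X :: "nat \<Rightarrow> real" and a assume X: "(\<forall>n. X n \<in> UNIV) \<and> X \<longlonglongrightarrow> a"
  show "(\<lambda>i. integral\<^sup>L M (k (X i))) \<longlonglongrightarrow> integral\<^sup>L M (k a)"
    by (rule integral_dominated_convergence[where w = w])
      (use w b X in \<open>auto intro!: continuous_on_tendsto_compose[OF c]\<close>)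
qed

text \<open>
  Fourier inversion writes \<open>f\<close> as an integral of waves, which may be differentiated under the
  integral as long as the powers of \<open>\<xi>\<close> that this produces keep the transform integrable. So
  \<open>D j\<close> is the \<open>j\<close>-th derivative of \<open>f\<close>.
\<close>

lemma sobolev_embedding:
  assumes f: "f \<in> sobolev r" and cont: "continuous_on UNIV f" and r: "r > 1 / 2"
  obtains D :: "nat \<Rightarrow> real \<Rightarrow> real" where "D 0 = f"
    and "\<And>j x. r > real j + 1 / 2 \<Longrightarrow> \<bar>D j x\<bar> \<le> embedding_const j r * sobolev_norm r f"
    and "\<And>j. r > real j + 1 / 2 \<Longrightarrow> continuous_on UNIV (D j)"
    and "\<And>j x. r > real (Suc j) + 1 / 2 \<Longrightarrow> (D j has_real_derivative D (Suc j) x) (at x)"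
proof -
  obtain g where g: "L2_fourier f g" "integrable lborel (\<lambda>\<xi>. (1 + \<xi>\<^sup>2) powr r * (norm (g \<xi>))\<^sup>2)"
    "sobolev_norm r f = sqrt (LINT \<xi>|lborel. (1 + \<xi>\<^sup>2) powr r * (norm (g \<xi>))\<^sup>2)"
    by (rule sobolev_some_transform[OF f])
  have [measurable]: "g \<in> borel_measurable borel"
    using g by (auto simp: L2_fourier_def square_integrable_def)
  note wti = weighted_transform_integrable[OF _ g(2)]
  define k where "k = (\<lambda>j x \<xi>. Re ((\<i> * of_real \<xi>) ^ j * g \<xi> * cis (x * \<xi>)))"
  define D where "D = (\<lambda>j x. (LINT \<xi>|lborel. k j x \<xi>) / (2 * pi))"
  have [measurable]: "k j x \<in> borel_measurable borel" for j x
    unfolding k_def by measurable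
  have kb: "\<bar>k j x \<xi>\<bar> \<le> \<bar>\<xi>\<bar> ^ j * norm (g \<xi>)" for j x \<xi>
    unfolding k_def by (rule order_trans[OF abs_Re_le_cmod]) (simp add: norm_mult norm_power)
  have ki: "integrable lborel (k j x)" if "r > real j + 1 / 2" for j x
    by (rule Bochner_Integration.integrable_bound[OF wti(1)[OF _ that]])
      (use kb in \<open>auto intro: order_trans[OF _ abs_ge_self]\<close>)
  have kd: "((\<lambda>x. k j x \<xi>) has_real_derivative k (Suc j) x \<xi>) (at x)" for j x \<xi>
  proof -
    have "((\<lambda>x. cis (x * \<xi>)) has_vector_derivative (\<i> * of_real \<xi> * cis (x * \<xi>))) (at x)"
      unfolding cis_conv_exp
      by (rule derivative_eq_intros refl has_vector_derivative_real_field | simp)+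
    then have "((\<lambda>x. (\<i> * of_real \<xi>) ^ j * g \<xi> * cis (x * \<xi>)) has_vector_derivative
        (\<i> * of_real \<xi>) ^ j * g \<xi> * (\<i> * of_real \<xi> * cis (x * \<xi>))) (at x)"
      by (rule has_vector_derivative_mult_right)
    then have "((\<lambda>x. Re ((\<i> * of_real \<xi>) ^ j * g \<xi> * cis (x * \<xi>))) has_vector_derivative
        Re ((\<i> * of_real \<xi>) ^ j * g \<xi> * (\<i> * of_real \<xi> * cis (x * \<xi>)))) (at x)"
      by (rule bounded_linear.has_vector_derivative[OF bounded_linear_Re])
    moreover have "(\<i> * of_real \<xi>) ^ j * g \<xi> * (\<i> * of_real \<xi> * cis (x * \<xi>)) =
        (\<i> * of_real \<xi>) ^ Suc j * g \<xi> * cis (x * \<xi>)"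
      by (simp only: power_Suc mult_ac)
    ultimately show ?thesis
      by (simp only: k_def has_real_derivative_iff_has_vector_derivative)
  qed
  show ?thesis
  proof (rule that)
    have gi: "integrable lborel g"
      using wti(1)[of 0] r by (subst integrable_norm_iff[symmetric]) auto
    have "D 0 x = f x" for x
    proof -
      have "(LINT \<xi>|lborel. k 0 x \<xi>) = Re (trig_integral g x)"
        unfolding k_def trig_integral_def
        by (subst integral_Re) (auto intro!: Bochner_Integration.integrable_bound[OF gi] simp: norm_mult)
      also have "\<dots> = 2 * pi * f x"
        using L2_fourier_inversion[OF g(1) cont gi] by simp
      finally show ?thesis by (simp add: D_def)
    qed
    then show "D 0 = f" by auto
    show "\<bar>D j x\<bar> \<le> embedding_const j r * sobolev_norm r f" if j: "r > real j + 1 / 2" for j x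
    proof -
      have "\<bar>LINT \<xi>|lborel. k j x \<xi>\<bar> \<le> (LINT \<xi>|lborel. \<bar>\<xi>\<bar> ^ j * norm (g \<xi>))"
        using Bochner_Integration.integral_norm_bound_integral[OF ki[OF j] wti(1)[OF _ j]] kb by simp
      also have "\<dots> \<le> 2 * pi * embedding_const j r * sobolev_norm r f"
        using wti(2)[OF _ j] g(3) by simp
      finally show ?thesis by (simp add: D_def field_simps)
    qed
    show "continuous_on UNIV (D j)" if j: "r > real j + 1 / 2" for j
      unfolding D_def
    proof (intro continuous_intros continuous_integral_dominated[where w = "\<lambda>\<xi>. \<bar>\<xi>\<bar> ^ j * norm (g \<xi>)"])
      show "continuous_on UNIV (\<lambda>x. k j x \<xi>)" for \<xi>
        using kd[of j \<xi>] by (meson DERIV_isCont continuous_at_imp_continuous_on)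
    qed (use kb wti(1)[OF _ j] in auto)
    show "(D j has_real_derivative D (Suc j) x) (at x)" if j: "r > real (Suc j) + 1 / 2" for j x
      unfolding D_def
    proof (rule DERIV_cdivide, rule DERIV_integral_dominated)
      show "integrable lborel (k j x)" for x using ki j by simp
      show "integrable lborel (\<lambda>\<xi>. \<bar>\<xi>\<bar> ^ Suc j * norm (g \<xi>))" by (rule wti(1)[OF _ j]) simp
      show "\<bar>k (Suc j) x \<xi>\<bar> \<le> \<bar>\<xi>\<bar> ^ Suc j * norm (g \<xi>)" for x \<xi> by (rule kb)
    qed (use kd in auto)
  qed
qed

section \<open>Decay at infinity and attained maxima\<close>

lemma tendsto_0_at_infinity_iff:
  fixes f :: "real \<Rightarrow> real"
  shows "(f \<longlongrightarrow> 0) at_infinity \<longleftrightarrow> (\<forall>\<epsilon>>0. \<exists>R. \<forall>x. R \<le> \<bar>x\<bar> \<longrightarrow> \<bar>f x\<bar> < \<epsilon>)"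
  by (simp add: tendsto_iff eventually_at_infinity dist_real_def)

text \<open>
  A value \<open>\<epsilon>\<close> of a Lipschitz function persists, up to a factor 2, on an interval of fixed
  length \<open>2 * \<delta>\<close>. Far out this would exceed the tail of the integral of \<open>f\<^sup>2\<close>.
\<close>

lemma square_integrable_Lipschitz_tendsto_0:
  fixes f :: "real \<Rightarrow> real"
  assumes sq: "square_integrable f" and L: "\<And>x y. \<bar>f x - f y\<bar> \<le> L * \<bar>x - y\<bar>"
  shows "(f \<longlongrightarrow> 0) at_infinity"
  unfolding tendsto_0_at_infinity_iff
proof (intro allI impI)
  fix \<epsilon> :: real assume \<epsilon>: "\<epsilon> > 0"
  have [measurable]: "f \<in> borel_measurable borel" and f2: "integrable lborel (\<lambda>x. (f x)\<^sup>2)"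
    using sq by (auto simp: square_integrable_def)
  have L0: "L \<ge> 0" using L[of 1 0] by simp
  \<comment> \<open>A radius on which \<open>f\<close> varies by at most \<open>\<epsilon> / 2\<close>.\<close>
  define \<delta> where "\<delta> = min 1 (\<epsilon> / (2 * L + 1))"
  have \<delta>: "\<delta> > 0" "\<delta> \<le> 1" using \<epsilon> L0 by (auto simp: \<delta>_def)
  have L\<delta>: "L * \<delta> \<le> \<epsilon> / 2"
  proof -
    have "L * \<delta> \<le> L * (\<epsilon> / (2 * L + 1))" by (intro mult_left_mono) (auto simp: \<delta>_def L0)
    also have "\<dots> \<le> \<epsilon> / 2" using L0 \<epsilon> by (simp add: field_simps)
    finally show ?thesis .
  qed
  define tail where "tail = (\<lambda>n. LINT y|lborel. indicator {y. real n < \<bar>y\<bar>} y * (f y)\<^sup>2)"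
  have ti: "integrable lborel (\<lambda>y. indicator {y. real n < \<bar>y\<bar>} y * (f y)\<^sup>2)" for n
    by (rule Bochner_Integration.integrable_bound[OF f2]) (auto simp: indicator_def)
  have "tail \<longlonglongrightarrow> (LINT y|(lborel :: real measure). (0::real))"
    unfolding tail_def
  proof (rule integral_dominated_convergence[where w = "\<lambda>y. (f y)\<^sup>2"])
    show "AE y in lborel. (\<lambda>n. indicator {y. real n < \<bar>y\<bar>} y * (f y)\<^sup>2) \<longlonglongrightarrow> 0"
    proof (rule AE_I2, rule tendsto_eventually)
      fix y :: real
      obtain N where N: "\<bar>y\<bar> \<le> real N" using real_arch_simple by blast
      show "\<forall>\<^sub>F n in sequentially. indicator {y. real n < \<bar>y\<bar>} y * (f y)\<^sup>2 = 0"
        using eventually_ge_at_top[of N] by eventually_elim (use N in \<open>auto simp: indicator_def\<close>)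
    qed
  qed (use f2 in \<open>auto simp: indicator_def\<close>)
  then have tail0: "tail \<longlonglongrightarrow> 0" by simp
  have "\<forall>\<^sub>F n in sequentially. tail n < 2 * \<delta> * (\<epsilon> / 2)\<^sup>2"
    by (rule order_tendstoD(2)[OF tail0]) (use \<epsilon> \<delta> in auto)
  then obtain n where n: "tail n < 2 * \<delta> * (\<epsilon> / 2)\<^sup>2"
    by (auto simp: eventually_sequentially)
  show "\<exists>R. \<forall>x. R \<le> \<bar>x\<bar> \<longrightarrow> \<bar>f x\<bar> < \<epsilon>"
  proof (intro exI allI impI, rule ccontr)
    fix x assume x: "real n + 2 \<le> \<bar>x\<bar>" and "\<not> \<bar>f x\<bar> < \<epsilon>"
    then have fx: "\<epsilon> \<le> \<bar>f x\<bar>" by simp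
    have "2 * \<delta> * (\<epsilon> / 2)\<^sup>2 = (LINT y|lborel. indicator {x - \<delta>..x + \<delta>} y * (\<epsilon> / 2)\<^sup>2)"
      using \<delta> by simp
    also have "\<dots> \<le> tail n"
      unfolding tail_def
    proof (rule Bochner_Integration.integral_mono[OF _ ti])
      show "integrable lborel (\<lambda>y. indicator {x - \<delta>..x + \<delta>} y * (\<epsilon> / 2)\<^sup>2)"
        by (intro integrable_mult_left integrable_real_indicator) (auto simp: emeasure_lborel_Icc_eq)
      fix y
      show "indicator {x - \<delta>..x + \<delta>} y * (\<epsilon> / 2)\<^sup>2 \<le> indicator {y. real n < \<bar>y\<bar>} y * (f y)\<^sup>2"
      proof (cases "y \<in> {x - \<delta>..x + \<delta>}")
        case True
        then have d: "\<bar>x - y\<bar> \<le> \<delta>" by auto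
        have "\<bar>f x - f y\<bar> \<le> L * \<delta>"
          using L[of x y] mult_left_mono[OF d L0] by linarith
        then have "\<epsilon> / 2 \<le> \<bar>f y\<bar>" using fx L\<delta> by linarith
        then have "(\<epsilon> / 2)\<^sup>2 \<le> \<bar>f y\<bar>\<^sup>2" using \<epsilon> by (intro power_mono) auto
        moreover have "real n < \<bar>y\<bar>" using x d \<delta> by linarith
        ultimately show ?thesis using True by simp
      qed simp
    qed
    finally show False using n by simp
  qed
qed

text \<open>
  Interpolation: over a step of length \<open>h\<close>, the derivative differs by at most \<open>L * h\<close> from a
  difference quotient of \<open>f\<close>, which is small far out.
\<close>

lemma tendsto_0_derivative:
  fixes f f1 f2 :: "real \<Rightarrow> real"
  assumes f: "(f \<longlongrightarrow> 0) at_infinity" and d: "\<And>x. (f has_real_derivative f1 x) (at x)"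
    and d2: "\<And>x. (f1 has_real_derivative f2 x) (at x)" and b: "\<And>x. \<bar>f2 x\<bar> \<le> L"
  shows "(f1 \<longlongrightarrow> 0) at_infinity"
  unfolding tendsto_0_at_infinity_iff
proof (intro allI impI)
  fix \<epsilon> :: real assume \<epsilon>: "\<epsilon> > 0"
  have L0: "L \<ge> 0" using b[of 0] by simp
  \<comment> \<open>The summand 1 only avoids a division by zero when \<open>L = 0\<close>; \<open>L * h < \<epsilon> / 2\<close> in any case.\<close>
  define h where "h = \<epsilon> / (2 * L + 1)"
  have h: "h > 0" using \<epsilon> L0 by (simp add: h_def add_nonneg_pos)
  have Lh: "L * h < \<epsilon> / 2" using L0 \<epsilon> by (simp add: h_def field_simps add_nonneg_pos)
  obtain R where R: "\<And>x. R \<le> \<bar>x\<bar> \<Longrightarrow> \<bar>f x\<bar> < h * \<epsilon> / 4"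
    using f[unfolded tendsto_0_at_infinity_iff, rule_format, of "h * \<epsilon> / 4"] h \<epsilon> by auto
  show "\<exists>R. \<forall>x. R \<le> \<bar>x\<bar> \<longrightarrow> \<bar>f1 x\<bar> < \<epsilon>"
  proof (intro exI allI impI)
    fix x assume x: "R + h \<le> \<bar>x\<bar>"
    have fx: "\<bar>f x\<bar> < h * \<epsilon> / 4" "\<bar>f (x + h)\<bar> < h * \<epsilon> / 4"
      using R[of x] R[of "x + h"] x h by linarith+
    obtain z where z: "x < z" "z < x + h" "f (x + h) - f x = (x + h - x) * f1 z"
      using MVT2[of x "x + h" f f1] d h by auto
    have "norm (f1 z - f1 x) \<le> L * norm (z - x)"
      by (rule field_differentiable_bound[of UNIV]) (use d2 b in auto)
    also have "\<dots> \<le> L * h" using z L0 by (intro mult_left_mono) auto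
    finally have "\<bar>f1 x\<bar> \<le> \<bar>f1 z\<bar> + L * h" by simp
    moreover have "h * \<bar>f1 z\<bar> < h * (\<epsilon> / 2)"
    proof -
      have "h * \<bar>f1 z\<bar> = \<bar>f (x + h) - f x\<bar>" using z h by (simp add: abs_mult)
      also have "\<dots> < h * \<epsilon> / 4 + h * \<epsilon> / 4" using fx by linarith
      finally show ?thesis by (simp add: mult.commute)
    qed
    then have "\<bar>f1 z\<bar> < \<epsilon> / 2" using h by simp
    ultimately show "\<bar>f1 x\<bar> < \<epsilon>" using Lh by linarith
  qed
qed

lemma attains_max_abs:
  fixes f :: "real \<Rightarrow> real"
  assumes cont: "continuous_on UNIV f" and lim: "(f \<longlongrightarrow> 0) at_infinity"
  obtains x where "\<And>y. \<bar>f y\<bar> \<le> \<bar>f x\<bar>"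
proof (cases "\<forall>y. f y = 0")
  case True
  then show ?thesis using that by simp
next
  case False
  then obtain y where y: "\<bar>f y\<bar> > 0" by auto
  then obtain R where R: "\<And>x. R \<le> \<bar>x\<bar> \<Longrightarrow> \<bar>f x\<bar> < \<bar>f y\<bar>"
    using lim unfolding tendsto_0_at_infinity_iff by blast
  have "\<exists>x\<in>{- \<bar>R\<bar>..\<bar>R\<bar>}. \<forall>z\<in>{- \<bar>R\<bar>..\<bar>R\<bar>}. \<bar>f z\<bar> \<le> \<bar>f x\<bar>"
    by (intro continuous_attains_sup continuous_intros continuous_on_subset[OF cont]) auto
  then obtain x where x: "\<And>z. z \<in> {- \<bar>R\<bar>..\<bar>R\<bar>} \<Longrightarrow> \<bar>f z\<bar> \<le> \<bar>f x\<bar>" by blast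
  have "y \<in> {- \<bar>R\<bar>..\<bar>R\<bar>}" using R[of y] by fastforce
  show ?thesis
  proof (rule that)
    fix z
    show "\<bar>f z\<bar> \<le> \<bar>f x\<bar>"
    proof (cases "z \<in> {- \<bar>R\<bar>..\<bar>R\<bar>}")
      case False
      then have "R \<le> \<bar>z\<bar>" by auto
      then show ?thesis using R[of z] x[OF \<open>y \<in> _\<close>] by linarith
    qed (use x in auto)
  qed
qed

section \<open>Maximum principles for the Helmholtz operator\<close>

lemma second_derivative_nonpos_at_max:
  fixes p p1 :: "real \<Rightarrow> real"
  assumes d: "\<And>x. (p has_real_derivative p1 x) (at x)"
    and d2: "(p1 has_real_derivative p2) (at x)" and max: "\<And>y. p y \<le> p x"
  shows "p2 \<le> 0"
proof (rule ccontr)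
  assume "\<not> p2 \<le> 0"
  then have pos: "p2 > 0" by simp
  have p1: "p1 x = 0"
    by (rule DERIV_local_max[OF d[of x], of 1]) (use max in auto)
  obtain e where e: "e > 0" "\<And>h. 0 < h \<Longrightarrow> h < e \<Longrightarrow> p1 x < p1 (x + h)"
    using DERIV_pos_inc_right[OF d2 pos] by blast
  obtain z where z: "x < z" "z < x + e / 2" "p (x + e / 2) - p x = (x + e / 2 - x) * p1 z"
    using MVT2[of x "x + e / 2" p p1] d e by auto
  have "p1 z > 0" using e(2)[of "z - x"] z e(1) p1 by simp
  then have "e / 2 * p1 z > 0" using e by simp
  then have "p (x + e / 2) - p x > 0" using z by simp
  then show False using max[of "x + e / 2"] by simp
qed

text \<open>
  At a positive maximum of \<open>p\<close> the second derivative is nonpositive, so there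
  \<open>p \<le> p - p'' \<le> B\<close>. The maximum is attained because \<open>p\<close> vanishes at infinity; it is found as the
  maximum of the absolute value of the positive part of \<open>p\<close>.
\<close>

lemma helmholtz_upper_bound:
  fixes p p1 p2 :: "real \<Rightarrow> real"
  assumes d: "\<And>x. (p has_real_derivative p1 x) (at x)" "\<And>x. (p1 has_real_derivative p2 x) (at x)"
    and lim: "(p \<longlongrightarrow> 0) at_infinity" and b: "\<And>x. p x - p2 x \<le> B" and B: "B \<ge> 0"
  shows "p x \<le> B"
proof (rule ccontr)
  assume x: "\<not> p x \<le> B"
  define q where "q = (\<lambda>x. max (p x) 0)"
  have "continuous_on UNIV p" using d(1) by (meson DERIV_isCont continuous_at_imp_continuous_on)
  then have "continuous_on UNIV q" unfolding q_def by (intro continuous_intros)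
  moreover have "(q \<longlongrightarrow> 0) at_infinity"
    using tendsto_max[OF lim tendsto_const, of 0] by (simp add: q_def)
  ultimately obtain z where "\<And>y. \<bar>q y\<bar> \<le> \<bar>q z\<bar>" using attains_max_abs by blast
  then have q: "q y \<le> q z" for y by (simp add: q_def)
  then have pz: "p z > B" using q[of x] x B by (auto simp: q_def max_def split: if_splits)
  have "p y \<le> p z" for y using q[of y] pz B by (auto simp: q_def max_def split: if_splits)
  then have "p2 z \<le> 0" by (rule second_derivative_nonpos_at_max[OF d(1) d(2)])
  then show False using b[of z] pz by linarith
qed

lemma helmholtz_nonneg:
  fixes p p1 p2 :: "real \<Rightarrow> real"
  assumes d: "\<And>x. (p has_real_derivative p1 x) (at x)" "\<And>x. (p1 has_real_derivative p2 x) (at x)"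
    and lim: "(p \<longlongrightarrow> 0) at_infinity" and b: "\<And>x. p x - p2 x \<ge> 0"
  shows "p x \<ge> 0"
  using helmholtz_upper_bound[of "\<lambda>x. - p x" "\<lambda>x. - p1 x" "\<lambda>x. - p2 x" 0 x]
    d b tendsto_minus[OF lim] by (fastforce intro: DERIV_minus)

text \<open>
  The maximum principle bounds \<open>p\<close> by \<open>B\<close>, hence \<open>p''\<close> by \<open>2 * B\<close>. A difference quotient of
  step 1 is at most \<open>2 * B\<close> and differs from \<open>p'\<close> by at most \<open>2 * B\<close>. These
  bounds take the place of estimates for the Green kernel of the Helmholtz operator.
\<close>

lemma helmholtz_bounds:
  fixes p p1 p2 :: "real \<Rightarrow> real"
  assumes d: "\<And>x. (p has_real_derivative p1 x) (at x)" "\<And>x. (p1 has_real_derivative p2 x) (at x)"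
    and lim: "(p \<longlongrightarrow> 0) at_infinity" and b: "\<And>x. \<bar>p x - p2 x\<bar> \<le> B"
  shows "\<bar>p x\<bar> \<le> B" and "\<bar>p1 x\<bar> \<le> 4 * B"
proof -
  have B: "B \<ge> 0" using b[of 0] by simp
  have 1: "p x \<le> B" for x
    by (rule helmholtz_upper_bound[OF d lim _ B]) (use b in \<open>auto simp: abs_le_iff\<close>)
  have 2: "- p x \<le> B" for x
  proof (rule helmholtz_upper_bound[of "\<lambda>x. - p x" "\<lambda>x. - p1 x" "\<lambda>x. - p2 x"])
    show "((\<lambda>x. - p x) \<longlongrightarrow> 0) at_infinity" using tendsto_minus[OF lim] by simp
    show "- p x - - p2 x \<le> B" for x using b[of x] by (simp add: abs_le_iff)
  qed (use B d in \<open>auto intro: DERIV_minus\<close>)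
  have p: "\<bar>p x\<bar> \<le> B" for x using 1[of x] 2[of x] by linarith
  then show "\<bar>p x\<bar> \<le> B" .
  have p2: "\<bar>p2 x\<bar> \<le> 2 * B" for x using p[of x] b[of x] by linarith
  obtain z where z: "x < z" "z < x + 1" "p (x + 1) - p x = (x + 1 - x) * p1 z"
    using MVT2[of x "x + 1" p p1] d by auto
  have "norm (p1 z - p1 x) \<le> (2 * B) * norm (z - x)"
    by (rule field_differentiable_bound[of UNIV]) (use d p2 in auto)
  also have "\<dots> \<le> (2 * B) * 1" using z B by (intro mult_left_mono) auto
  finally have "\<bar>p1 z - p1 x\<bar> \<le> 2 * B" by simp
  then show "\<bar>p1 x\<bar> \<le> 4 * B" using z p[of x] p[of "x + 1"] by simp
qed

text \<open>
  The factorisation \<open>p'' - p = (d/dx + 1) (d/dx - 1) p\<close>: the first factor makes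
  \<open>exp x * (p' - p)\<close> nonincreasing and hence nonpositive for \<open>x \<ge> 0\<close>, and the second then makes
  \<open>exp (- x) * p\<close> nonincreasing. Both start from 0, because 0 is a minimum of \<open>p\<close>.
\<close>

lemma helmholtz_zero_right:
  fixes p p1 p2 :: "real \<Rightarrow> real"
  assumes d: "\<And>x. (p has_real_derivative p1 x) (at x)" "\<And>x. (p1 has_real_derivative p2 x) (at x)"
    and p: "\<And>x. p x \<ge> 0" and b: "\<And>x. p2 x \<le> p x" and 0: "p 0 = 0" and x: "x \<ge> 0"
  shows "p x = 0"
proof -
  have p10: "p1 0 = 0"
    by (rule DERIV_local_min[OF d(1)[of 0], of 1]) (use p 0 in auto)
  have "exp x * (p1 x - p x) \<le> exp 0 * (p1 0 - p 0)" if "x \<ge> 0" for x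
  proof (rule DERIV_nonpos_imp_nonincreasing[OF that])
    fix y
    have "((\<lambda>x. exp x * (p1 x - p x)) has_real_derivative exp y * (p2 y - p1 y) + exp y * (p1 y - p y)) (at y)"
      by (rule derivative_eq_intros d refl | simp)+
    moreover have "exp y * (p2 y - p1 y) + exp y * (p1 y - p y) = exp y * (p2 y - p y)"
      by (simp add: algebra_simps)
    moreover have "exp y * (p2 y - p y) \<le> 0" using b[of y] by (simp add: mult_le_0_iff)
    ultimately show "\<exists>D. ((\<lambda>x. exp x * (p1 x - p x)) has_real_derivative D) (at y) \<and> D \<le> 0" by auto
  qed
  then have p1: "p1 x \<le> p x" if "x \<ge> 0" for x using p10 0 that by (simp add: mult_le_0_iff)
  have "exp (- x) * p x \<le> exp (- 0) * p 0"
  proof (rule DERIV_nonpos_imp_nonincreasing[OF x])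
    fix y :: real assume y: "0 \<le> y"
    have "((\<lambda>x. exp (- x) * p x) has_real_derivative - exp (- y) * p y + exp (- y) * p1 y) (at y)"
      by (rule derivative_eq_intros d refl | simp)+
    moreover have "- exp (- y) * p y + exp (- y) * p1 y = exp (- y) * (p1 y - p y)"
      by (simp add: algebra_simps)
    moreover have "exp (- y) * (p1 y - p y) \<le> 0" using p1[OF y] by (simp add: mult_le_0_iff)
    ultimately show "\<exists>D. ((\<lambda>x. exp (- x) * p x) has_real_derivative D) (at y) \<and> D \<le> 0" by auto
  qed
  then show ?thesis using p[of x] 0 by (simp add: mult_le_0_iff)
qed

lemma helmholtz_strong_minimum:
  fixes p p1 p2 :: "real \<Rightarrow> real"
  assumes d: "\<And>x. (p has_real_derivative p1 x) (at x)" "\<And>x. (p1 has_real_derivative p2 x) (at x)"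
    and p: "\<And>x. p x \<ge> 0" and b: "\<And>x. p2 x \<le> p x" and 0: "p 0 = 0"
  shows "p x = 0"
proof (cases "x \<ge> 0")
  case True
  then show ?thesis by (rule helmholtz_zero_right[OF d p b 0])
next
  case False
  have r: "((\<lambda>x. h (- x)) has_real_derivative - h' (- x)) (at x)"
    if "\<And>x. (h has_real_derivative h' x) (at x)" for h h' :: "real \<Rightarrow> real" and x
    using DERIV_chain2[OF that[of "- x"] DERIV_minus[OF DERIV_ident]] by simp
  have "p (- (- x)) = 0"
    by (rule helmholtz_zero_right[of "\<lambda>x. p (- x)" "\<lambda>x. - p1 (- x)" "\<lambda>x. - (- p2 (- x))"])
      (use False p b 0 r[OF d(1)] DERIV_minus[OF r[OF d(2)]] in auto)
  then show ?thesis by simp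
qed

section \<open>Differential inequalities\<close>

text \<open>
  The source \<open>q\<close> makes \<open>g\<close> positive at some \<open>t1 > 0\<close>. From then on \<open>- 1 / g\<close> grows at least
  at the rate \<open>c\<close>, so it would reach 0 by time \<open>t1 + 1 / (c * g t1)\<close>.
\<close>

lemma riccati_blow_up:
  fixes g q :: "real \<Rightarrow> real"
  assumes d: "\<And>t. t \<ge> 0 \<Longrightarrow> (g has_real_derivative c * (g t)\<^sup>2 + q t) (at t within {0..})"
    and q: "\<And>t. t \<ge> 0 \<Longrightarrow> q t \<ge> 0" and q0: "q 0 > 0" and g0: "g 0 = 0" and c: "c > 0"
  shows False
proof -
  have "((\<lambda>t. (g t - g 0) / (t - 0)) \<longlongrightarrow> q 0) (at 0 within {0..})"
    using d[of 0] g0 by (simp add: has_field_derivative_iff)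
  then have "\<forall>\<^sub>F t in at 0 within {0..}. (g t - g 0) / (t - 0) > 0"
    using q0 by (rule order_tendstoD(1))
  then obtain e where e: "e > 0" "\<And>t. t \<in> {0..} \<Longrightarrow> t \<noteq> 0 \<Longrightarrow> dist t 0 < e \<Longrightarrow> (g t - g 0) / (t - 0) > 0"
    unfolding eventually_at by blast
  define t1 where "t1 = e / 2"
  have t1: "t1 > 0" using e by (simp add: t1_def)
  have gt1: "g t1 > 0" using e(2)[of t1] e(1) g0 by (simp add: t1_def zero_less_divide_iff)
  have D: "(g has_real_derivative c * (g t)\<^sup>2 + q t) (at t)" if "t > 0" for t
  proof -
    have "at t within {0..} = at t" using that by (intro at_within_interior) auto
    then show ?thesis using d[of t] that by simp
  qed
  have mono: "g t1 \<le> g t" if "t1 \<le> t" for t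
  proof (rule DERIV_nonneg_imp_nondecreasing[OF that])
    fix y assume "t1 \<le> y"
    then show "\<exists>D. (g has_real_derivative D) (at y) \<and> 0 \<le> D"
      using D[of y] q[of y] t1 c by (intro exI[of _ "c * (g y)\<^sup>2 + q y"]) auto
  qed
  define t2 where "t2 = t1 + 1 / (c * g t1)"
  have t12: "t1 \<le> t2" using c gt1 by (simp add: t2_def)
  have "- 1 / g t1 - c * t1 \<le> - 1 / g t2 - c * t2"
  proof (rule DERIV_nonneg_imp_nondecreasing[OF t12])
    fix y assume y: "t1 \<le> y"
    have gy: "g y > 0" using mono[OF y] gt1 by simp
    have Dy: "(g has_real_derivative c * (g y)\<^sup>2 + q y) (at y)" using D y t1 by simp
    have "((\<lambda>t. - 1 / g t - c * t) has_real_derivative (c * (g y)\<^sup>2 + q y) / (g y)\<^sup>2 - c) (at y)"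
      by (rule derivative_eq_intros Dy refl | use gy in \<open>simp add: power2_eq_square\<close>)+
    moreover have "(c * (g y)\<^sup>2 + q y) / (g y)\<^sup>2 - c \<ge> 0"
      using gy q[of y] y t1 by (simp add: field_simps)
    ultimately show "\<exists>D. ((\<lambda>t. - 1 / g t - c * t) has_real_derivative D) (at y) \<and> 0 \<le> D" by blast
  qed
  moreover have "c * t2 = c * t1 + 1 / g t1" using c gt1 by (simp add: t2_def field_simps)
  ultimately have "1 / g t2 \<le> 0" by simp
  moreover have "g t2 > 0" using mono[OF t12] gt1 by simp
  ultimately show False by (simp add: divide_le_0_iff)
qed

text \<open>
  Continuity in time, on the half-line, with respect to the supremum norm over the index.
\<close>

definition sup_continuous :: "(real \<Rightarrow> 'i \<Rightarrow> real) \<Rightarrow> bool" where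
  "sup_continuous h \<longleftrightarrow> (\<forall>t\<ge>0. \<forall>\<epsilon>>0. \<exists>\<delta>>0. \<forall>\<tau>\<ge>0. \<bar>\<tau> - t\<bar> < \<delta> \<longrightarrow> (\<forall>i. \<bar>h \<tau> i - h t i\<bar> \<le> \<epsilon>))"

lemma sup_continuousD:
  assumes "sup_continuous h" "t \<ge> 0" "\<epsilon> > 0"
  obtains \<delta> where "\<delta> > 0" "\<And>\<tau> i. \<tau> \<ge> 0 \<Longrightarrow> \<bar>\<tau> - t\<bar> < \<delta> \<Longrightarrow> \<bar>h \<tau> i - h t i\<bar> \<le> \<epsilon>"
  using assms unfolding sup_continuous_def by meson

lemma sup_continuous_bounded:
  assumes h: "sup_continuous h" and b: "\<And>t. t \<ge> 0 \<Longrightarrow> \<exists>B. \<forall>i. \<bar>h t i\<bar> \<le> B"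
  obtains M where "\<And>t i. 0 \<le> t \<Longrightarrow> t \<le> \<tau> \<Longrightarrow> \<bar>h t i\<bar> \<le> M"
proof -
  obtain B where B: "\<And>t i. t \<ge> 0 \<Longrightarrow> \<bar>h t i\<bar> \<le> B t" using b by metis
  obtain \<delta> where \<delta>: "\<And>t. t \<ge> 0 \<Longrightarrow> \<delta> t > 0"
    "\<And>t s i. t \<ge> 0 \<Longrightarrow> s \<ge> 0 \<Longrightarrow> \<bar>s - t\<bar> < \<delta> t \<Longrightarrow> \<bar>h s i - h t i\<bar> \<le> 1"
  proof -
    have "\<exists>\<delta>. \<delta> > 0 \<and> (\<forall>s\<ge>0. \<bar>s - t\<bar> < \<delta> \<longrightarrow> (\<forall>i. \<bar>h s i - h t i\<bar> \<le> 1))" if "t \<ge> 0" for t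
      using h that zero_less_one unfolding sup_continuous_def by blast
    then show ?thesis using that by metis
  qed
  have "{0..\<tau>} \<subseteq> (\<Union>t\<in>{0..\<tau>}. ball t (\<delta> t))" using \<delta>(1) by force
  then obtain S where S: "S \<subseteq> {0..\<tau>}" "finite S" "{0..\<tau>} \<subseteq> (\<Union>t\<in>S. ball t (\<delta> t))"
    using compactE_image[of "{0..\<tau>}" "{0..\<tau>}" "\<lambda>t. ball t (\<delta> t)"] by auto
  show ?thesis
  proof (rule that)
    fix s i assume "0 \<le> s" "s \<le> \<tau>"
    then obtain t where t: "t \<in> S" "s \<in> ball t (\<delta> t)" using S(3) by force
    have t0: "t \<ge> 0" using t S by auto
    have "\<bar>h s i - h t i\<bar> \<le> 1" by (rule \<delta>(2)) (use t t0 \<open>0 \<le> s\<close> in \<open>auto simp: dist_real_def\<close>)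
    then have "\<bar>h s i\<bar> \<le> \<bar>B t\<bar> + 1" using B[OF t0, of i] by linarith
    also have "\<bar>B t\<bar> \<le> (\<Sum>t\<in>S. \<bar>B t\<bar>)" by (rule member_le_sum) (use t S in auto)
    finally show "\<bar>h s i\<bar> \<le> (\<Sum>t\<in>S. \<bar>B t\<bar>) + 1" by simp
  qed
qed

text \<open>
  A Gronwall argument for the supremum of a family that never differentiates the supremum:
  the growth bound is required only at indices where the supremum is attained. There, derivatives
  in space of the quantity being maximised vanish, and this is what controls transport
  terms. If \<open>\<phi>\<close> ever reached \<open>\<epsilon> * exp (L * t)\<close> with \<open>L > C\<close>, then at the first such time the
  maximal member would have to grow at least at the rate \<open>L\<close>.
\<close>

lemma gronwall_maximum_principle:
  fixes \<phi> :: "real \<Rightarrow> 'i \<Rightarrow> real"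
  assumes uc: "sup_continuous \<phi>" and init: "\<And>i. \<phi> 0 i \<le> 0"
    and att: "\<And>t. 0 \<le> t \<Longrightarrow> t \<le> \<tau> \<Longrightarrow> \<exists>i. \<forall>j. \<phi> t j \<le> \<phi> t i"
    and der: "\<And>t i. 0 \<le> t \<Longrightarrow> t \<le> \<tau> \<Longrightarrow> \<phi> t i > 0 \<Longrightarrow> (\<And>j. \<phi> t j \<le> \<phi> t i) \<Longrightarrow>
       \<exists>d. ((\<lambda>s. \<phi> s i) has_real_derivative d) (at t within {0..}) \<and> d \<le> C * \<phi> t i"
    and C: "C \<ge> 0" and t: "0 \<le> t" "t \<le> \<tau>"
  shows "\<phi> t i \<le> 0"
proof (rule field_le_epsilon)
  fix \<eta> :: real assume \<eta>: "\<eta> > 0"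
  define L where "L = C + 1"
  define \<epsilon> where "\<epsilon> = \<eta> / exp (L * \<tau>)"
  have \<epsilon>: "\<epsilon> > 0" using \<eta> by (simp add: \<epsilon>_def)
  have "\<phi> t i < \<epsilon> * exp (L * t)"
  proof (rule ccontr)
    assume neg: "\<not> \<phi> t i < \<epsilon> * exp (L * t)"
    define A where "A = {t\<in>{0..\<tau>}. \<exists>i. \<epsilon> * exp (L * t) \<le> \<phi> t i}"
    define t0 where "t0 = Inf A"
    have tA: "t \<in> A" using neg t by (auto simp: A_def not_less)
    have bdd: "bdd_below A" by (intro bdd_belowI[of _ 0]) (auto simp: A_def)
    have A_ge: "t0 \<le> s" if "s \<in> A" for s
      unfolding t0_def by (rule cInf_lower[OF that bdd])
    have t0: "0 \<le> t0" "t0 \<le> \<tau>"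
    proof -
      show "0 \<le> t0" unfolding t0_def by (rule cInf_greatest) (use tA in \<open>auto simp: A_def\<close>)
      show "t0 \<le> \<tau>" using A_ge[OF tA] t by simp
    qed
    have below: "\<phi> s j < \<epsilon> * exp (L * s)" if "0 \<le> s" "s < t0" for s j
    proof (rule ccontr)
      assume "\<not> ?thesis"
      then have "s \<in> A" using that t0 by (auto simp: A_def not_less)
      then show False using A_ge[of s] that by simp
    qed
    obtain m where m: "\<And>j. \<phi> t0 j \<le> \<phi> t0 m" using att[OF t0] by blast
    have ge: "\<epsilon> * exp (L * t0) \<le> \<phi> t0 m"
    proof (rule field_le_epsilon)
      fix e :: real assume e: "e > 0"
      obtain \<delta> where \<delta>: "\<delta> > 0" "\<And>s j. s \<ge> 0 \<Longrightarrow> \<bar>s - t0\<bar> < \<delta> \<Longrightarrow> \<bar>\<phi> s j - \<phi> t0 j\<bar> \<le> e"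
        using sup_continuousD[OF uc t0(1) e] by blast
      obtain s where s: "s \<in> A" "s < t0 + \<delta>"
        using cInf_lessD[of A "t0 + \<delta>"] tA \<delta>(1) unfolding t0_def by auto
      have st: "t0 \<le> s" by (rule A_ge[OF s(1)])
      obtain j where j: "\<epsilon> * exp (L * s) \<le> \<phi> s j" and "s \<ge> 0" using s by (auto simp: A_def)
      have "\<epsilon> * exp (L * t0) \<le> \<epsilon> * exp (L * s)" using \<epsilon> st C by (simp add: L_def)
      also have "\<dots> \<le> \<phi> s j" by (rule j)
      also have "\<dots> \<le> \<phi> t0 j + e" using \<delta>(2)[OF \<open>s \<ge> 0\<close>, of j] st s(2) by (simp add: abs_le_iff)
      also have "\<dots> \<le> \<phi> t0 m + e" using m by simp
      finally show "\<epsilon> * exp (L * t0) \<le> \<phi> t0 m + e" .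
    qed
    have pos: "\<phi> t0 m > 0"
    proof -
      have "0 < \<epsilon> * exp (L * t0)" using \<epsilon> by simp
      then show ?thesis using ge by linarith
    qed
    have t0pos: "t0 > 0"
    proof (rule ccontr)
      assume "\<not> t0 > 0"
      then have "t0 = 0" using t0 by simp
      then show False using init[of m] pos by simp
    qed
    obtain d where d: "((\<lambda>s. \<phi> s m) has_real_derivative d) (at t0 within {0..})" "d \<le> C * \<phi> t0 m"
      using der[OF t0 pos m] by blast
    have "at t0 within {0..} = at t0" using t0pos by (intro at_within_interior) auto
    then have d': "((\<lambda>s. \<phi> s m) has_real_derivative d) (at t0)" using d by simp
    have "((\<lambda>s. \<phi> s m - \<epsilon> * exp (L * s)) has_real_derivative d - \<epsilon> * (L * exp (L * t0))) (at t0)"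
      by (rule derivative_eq_intros d' refl | simp)+
    moreover have "d - \<epsilon> * (L * exp (L * t0)) < 0"
    proof -
      have "\<phi> t0 m \<le> \<epsilon> * exp (L * t0)"
      proof (rule ccontr)
        assume "\<not> ?thesis"
        then have gap: "\<phi> t0 m - \<epsilon> * exp (L * t0) > 0" by simp
        have "isCont (\<lambda>s. \<phi> s m - \<epsilon> * exp (L * s)) t0"
          by (intro continuous_intros DERIV_isCont[OF d'])
        then have "\<forall>\<^sub>F s in at t0. \<phi> s m - \<epsilon> * exp (L * s) > 0"
          using gap by (intro order_tendstoD(1)[of _ "\<phi> t0 m - \<epsilon> * exp (L * t0)"]) (auto simp: isCont_def)
        then obtain e where e: "e > 0" "\<And>s. s \<noteq> t0 \<Longrightarrow> dist s t0 < e \<Longrightarrow> \<phi> s m - \<epsilon> * exp (L * s) > 0"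
          unfolding eventually_at by blast
        \<comment> \<open>An earlier time, close to \<open>t0\<close> and still nonnegative, at which \<open>\<phi>\<close> exceeds the barrier.\<close>
        define s where "s = max (t0 / 2) (t0 - e / 2)"
        have "s < t0" "0 \<le> s" "dist s t0 < e" using t0pos e by (auto simp: s_def dist_real_def)
        then show False using e(2)[of s] below[of s m] by simp
      qed
      then have eq: "\<phi> t0 m = \<epsilon> * exp (L * t0)" using ge by simp
      have "\<epsilon> * (L * exp (L * t0)) = C * \<phi> t0 m + \<phi> t0 m"
        by (simp add: eq L_def algebra_simps)
      then show ?thesis using d(2) pos by linarith
    qed
    ultimately obtain e where e: "e > 0"
      "\<And>h. 0 < h \<Longrightarrow> h < e \<Longrightarrow> \<phi> t0 m - \<epsilon> * exp (L * t0) < \<phi> (t0 - h) m - \<epsilon> * exp (L * (t0 - h))"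
      using DERIV_neg_dec_left by blast
    \<comment> \<open>A slightly earlier time at which the barrier is already crossed, against the choice of \<open>t0\<close>.\<close>
    define h where "h = min (t0 / 2) (e / 2)"
    have h: "0 < h" "h < e" "0 \<le> t0 - h" "t0 - h < t0" using t0pos e(1) by (auto simp: h_def)
    show False using e(2)[OF h(1,2)] below[OF h(3,4), of m] ge by linarith
  qed
  also have "\<epsilon> * exp (L * t) \<le> \<epsilon> * exp (L * \<tau>)" using \<epsilon> t C by (simp add: L_def)
  also have "\<dots> = \<eta>" by (simp add: \<epsilon>_def)
  finally show "\<phi> t i \<le> 0 + \<eta>" by simp
qed

section \<open>Time regularity of curves in Sobolev spaces\<close>

lemma sobolev_deriv:
  assumes f: "f \<in> sobolev r" and cont: "continuous_on UNIV f" and r: "r > real j + 1 / 2"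
  shows "\<bar>(deriv ^^ j) f x\<bar> \<le> embedding_const j r * sobolev_norm r f"
    and "continuous_on UNIV ((deriv ^^ j) f)"
    and "r > real (Suc j) + 1 / 2 \<Longrightarrow> ((deriv ^^ j) f has_real_derivative (deriv ^^ Suc j) f x) (at x)"
proof -
  have "r > 1 / 2" using r by linarith
  then obtain D where D: "D 0 = f"
    "\<And>j x. r > real j + 1 / 2 \<Longrightarrow> \<bar>D j x\<bar> \<le> embedding_const j r * sobolev_norm r f"
    "\<And>j. r > real j + 1 / 2 \<Longrightarrow> continuous_on UNIV (D j)"
    "\<And>j x. r > real (Suc j) + 1 / 2 \<Longrightarrow> (D j has_real_derivative D (Suc j) x) (at x)"
    using sobolev_embedding[OF f cont] by metis
  have eq: "(deriv ^^ j) f = D j" if "r > real j + 1 / 2" for j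
    using that
  proof (induction j)
    case (Suc j)
    then have "(deriv ^^ j) f = D j" by simp
    then show ?case using D(4)[OF Suc.prems] by (auto intro!: ext DERIV_imp_deriv)
  qed (simp add: D)
  show "\<bar>(deriv ^^ j) f x\<bar> \<le> embedding_const j r * sobolev_norm r f"
    "continuous_on UNIV ((deriv ^^ j) f)"
    using D(2,3)[OF r] eq[OF r] by auto
  show "((deriv ^^ j) f has_real_derivative (deriv ^^ Suc j) f x) (at x)" if "r > real (Suc j) + 1 / 2"
    using D(4)[OF that] eq[OF r] eq[OF that] by simp
qed

lemma sobolev_deriv_lincomb:
  assumes f: "f \<in> sobolev r" "continuous_on UNIV f" and h: "h \<in> sobolev r" "continuous_on UNIV h"
    and r: "r > real j + 1 / 2"
  shows "(deriv ^^ j) (\<lambda>x. f x + c * h x) = (\<lambda>x. (deriv ^^ j) f x + c * (deriv ^^ j) h x)"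
  using r
proof (induction j)
  case (Suc j)
  have rj: "r > real j + 1 / 2" using Suc.prems by simp
  show ?case
  proof
    fix x
    have "((\<lambda>x. (deriv ^^ j) f x + c * (deriv ^^ j) h x) has_real_derivative
        (deriv ^^ Suc j) f x + c * (deriv ^^ Suc j) h x) (at x)"
      by (intro DERIV_add DERIV_cmult sobolev_deriv(3)[OF f rj Suc.prems] sobolev_deriv(3)[OF h rj Suc.prems])
    then show "(deriv ^^ Suc j) (\<lambda>x. f x + c * h x) x = (deriv ^^ Suc j) f x + c * (deriv ^^ Suc j) h x"
      using Suc.IH[OF rj] by (simp add: DERIV_imp_deriv)
  qed
qed simp

lemma sobolev_tendsto_0:
  assumes f: "f \<in> sobolev r" and cont: "continuous_on UNIV f" and r: "r > 3 / 2"
  shows "(f \<longlongrightarrow> 0) at_infinity"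
proof (rule square_integrable_Lipschitz_tendsto_0)
  show "square_integrable f" using f by (auto simp: sobolev_def L2_fourier_def)
  fix x y
  have d: "(f has_real_derivative deriv f x) (at x)" for x
    using sobolev_deriv(3)[OF f cont, of 0] r by simp
  have b: "\<bar>deriv f x\<bar> \<le> embedding_const 1 r * sobolev_norm r f" for x
    using sobolev_deriv(1)[OF f cont, of 1] r by simp
  have "norm (f x - f y) \<le> embedding_const 1 r * sobolev_norm r f * norm (x - y)"
    by (rule field_differentiable_bound[of UNIV]) (use d b in auto)
  then show "\<bar>f x - f y\<bar> \<le> embedding_const 1 r * sobolev_norm r f * \<bar>x - y\<bar>" by simp
qed

lemma time_interval_infinity: "time_interval \<infinity> = {0..}"
  by (auto simp: time_interval_def)

lemma sobolev_C0_sup_continuous: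
  assumes f: "sobolev_C0 \<infinity> r f" and cont: "\<And>t. t \<ge> 0 \<Longrightarrow> continuous_on UNIV (f t)"
    and r: "r > real j + 1 / 2"
  shows "sup_continuous (\<lambda>t. (deriv ^^ j) (f t))"
  unfolding sup_continuous_def
proof (intro allI impI)
  fix t \<epsilon> :: real assume t: "t \<ge> 0" and \<epsilon>: "\<epsilon> > 0"
  have fs: "f t \<in> sobolev r" if "t \<ge> 0" for t
    using f that by (simp add: sobolev_C0_def time_interval_infinity)
  have "((\<lambda>\<tau>. sobolev_norm r (\<lambda>x. f \<tau> x - f t x)) \<longlongrightarrow> 0) (at t within {0..})"
    using f t by (simp add: sobolev_C0_def time_interval_infinity)
  then have "((\<lambda>\<tau>. embedding_const j r * sobolev_norm r (\<lambda>x. f \<tau> x - f t x)) \<longlongrightarrow> embedding_const j r * 0) (at t within {0..})"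
    by (intro tendsto_intros)
  then have "\<forall>\<^sub>F \<tau> in at t within {0..}. embedding_const j r * sobolev_norm r (\<lambda>x. f \<tau> x - f t x) < \<epsilon>"
    by (rule order_tendstoD(2)) (use \<epsilon> in simp)
  then obtain \<delta> where \<delta>: "\<delta> > 0" "\<And>\<tau>. \<tau> \<in> {0..} \<Longrightarrow> \<tau> \<noteq> t \<Longrightarrow> dist \<tau> t < \<delta> \<Longrightarrow>
      embedding_const j r * sobolev_norm r (\<lambda>x. f \<tau> x - f t x) < \<epsilon>"
    unfolding eventually_at by blast
  have "\<bar>(deriv ^^ j) (f \<tau>) x - (deriv ^^ j) (f t) x\<bar> \<le> \<epsilon>" if \<tau>: "\<tau> \<ge> 0" "\<bar>\<tau> - t\<bar> < \<delta>" for \<tau> x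
  proof (cases "\<tau> = t")
    case False
    have s: "(\<lambda>x. f \<tau> x + (- 1) * f t x) \<in> sobolev r"
      by (rule sobolev_lincomb[OF fs fs]) (use \<tau> t in auto)
    have c: "continuous_on UNIV (\<lambda>x. f \<tau> x + (- 1) * f t x)"
      by (intro continuous_intros cont) (use \<tau> t in auto)
    have "\<bar>(deriv ^^ j) (f \<tau>) x + (- 1) * (deriv ^^ j) (f t) x\<bar>
        \<le> embedding_const j r * sobolev_norm r (\<lambda>x. f \<tau> x + (- 1) * f t x)"
      using sobolev_deriv(1)[OF s c r, of x]
        sobolev_deriv_lincomb[OF fs[OF \<tau>(1)] cont[OF \<tau>(1)] fs[OF t] cont[OF t] r, of "- 1"] by simp
    also have "\<dots> \<le> \<epsilon>" using \<delta>(2)[of \<tau>] False \<tau> by (simp add: dist_real_def)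
    finally show ?thesis by simp
  qed (use \<epsilon> in simp)
  then show "\<exists>\<delta>>0. \<forall>\<tau>\<ge>0. \<bar>\<tau> - t\<bar> < \<delta> \<longrightarrow> (\<forall>x. \<bar>(deriv ^^ j) (f \<tau>) x - (deriv ^^ j) (f t) x\<bar> \<le> \<epsilon>)"
    using \<delta>(1) by blast
qed

lemma sobolev_C0_bounded:
  assumes f: "sobolev_C0 \<infinity> r f" and cont: "\<And>t. t \<ge> 0 \<Longrightarrow> continuous_on UNIV (f t)"
    and r: "r > real j + 1 / 2"
  obtains M where "\<And>t x. 0 \<le> t \<Longrightarrow> t \<le> \<tau> \<Longrightarrow> \<bar>(deriv ^^ j) (f t) x\<bar> \<le> M"
proof (rule sup_continuous_bounded[OF sobolev_C0_sup_continuous[OF f cont r]])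
  show "\<exists>B. \<forall>x. \<bar>(deriv ^^ j) (f t) x\<bar> \<le> B" if "t \<ge> 0" for t
    using f that sobolev_deriv(1)[OF _ cont[OF that] r]
    unfolding sobolev_C0_def time_interval_infinity by blast
qed auto

text \<open>
  The difference quotient minus \<open>f'\<close> is an element of the Sobolev space whose norm tends to 0;
  the embedding turns this into convergence of its \<open>j\<close>-th derivative at each point.
\<close>

lemma sobolev_C1_time_derivative:
  assumes f: "sobolev_C1 \<infinity> r f f'" and cont: "\<And>t. t \<ge> 0 \<Longrightarrow> continuous_on UNIV (f t)"
    and cont': "\<And>t. t \<ge> 0 \<Longrightarrow> continuous_on UNIV (f' t)"
    and r: "r > real j + 1 / 2" and t: "t \<ge> 0"
  shows "((\<lambda>\<tau>. (deriv ^^ j) (f \<tau>) x) has_real_derivative (deriv ^^ j) (f' t) x) (at t within {0..})"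
  unfolding has_field_derivative_iff
proof (rule LIM_zero_cancel, rule Lim_null_comparison)
  have fs: "f t \<in> sobolev r" "f' t \<in> sobolev r" if "t \<ge> 0" for t
    using f that by (auto simp: sobolev_C1_def sobolev_C0_def time_interval_infinity)
  have "((\<lambda>\<tau>. sobolev_norm r (\<lambda>x. (f \<tau> x - f t x) / (\<tau> - t) - f' t x)) \<longlongrightarrow> 0) (at t within {0..})"
    using f t by (auto simp: sobolev_C1_def time_interval_infinity)
  then have "((\<lambda>\<tau>. embedding_const j r * sobolev_norm r (\<lambda>x. (f \<tau> x - f t x) / (\<tau> - t) - f' t x))
      \<longlongrightarrow> embedding_const j r * 0) (at t within {0..})"
    by (intro tendsto_intros)
  then show "((\<lambda>\<tau>. embedding_const j r * sobolev_norm r (\<lambda>x. (f \<tau> x - f t x) / (\<tau> - t) - f' t x))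
      \<longlongrightarrow> 0) (at t within {0..})" by simp
  show "\<forall>\<^sub>F \<tau> in at t within {0..}.
      norm (((deriv ^^ j) (f \<tau>) x - (deriv ^^ j) (f t) x) / (\<tau> - t) - (deriv ^^ j) (f' t) x)
      \<le> embedding_const j r * sobolev_norm r (\<lambda>x. (f \<tau> x - f t x) / (\<tau> - t) - f' t x)"
    unfolding eventually_at_filter
  proof (intro always_eventually allI impI)
    fix \<tau> assume \<tau>: "\<tau> \<noteq> t" "\<tau> \<in> {0..}"
    define c where "c = 1 / (\<tau> - t)"
    define d where "d = (\<lambda>x. f \<tau> x + (- 1) * f t x)"
    have ds: "d \<in> sobolev r" "continuous_on UNIV d"
      unfolding d_def by (intro sobolev_lincomb fs continuous_intros cont; use \<tau> t in simp)+
    define e where "e = (\<lambda>x. f' t x + (- c) * d x)"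
    have es: "e \<in> sobolev r" "continuous_on UNIV e"
      unfolding e_def by (intro sobolev_lincomb fs ds continuous_intros cont'; use t in simp)+
    define q where "q = (\<lambda>x. 0 + (- 1) * e x)"
    have qs: "q \<in> sobolev r" "continuous_on UNIV q"
      unfolding q_def by (intro sobolev_lincomb sobolev_zero es continuous_intros)+
    have q: "q = (\<lambda>x. (f \<tau> x - f t x) / (\<tau> - t) - f' t x)"
      by (auto simp: q_def e_def d_def c_def)
    have "(deriv ^^ j) q x = 0 + (- 1) * ((deriv ^^ j) (f' t) x + (- c) * ((deriv ^^ j) (f \<tau>) x + (- 1) * (deriv ^^ j) (f t) x))"
    proof -
      have 1: "(deriv ^^ j) d = (\<lambda>x. (deriv ^^ j) (f \<tau>) x + (- 1) * (deriv ^^ j) (f t) x)"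
        unfolding d_def by (rule sobolev_deriv_lincomb[OF fs(1) cont fs(1) cont r]) (use \<tau> t in auto)
      have 2: "(deriv ^^ j) e = (\<lambda>x. (deriv ^^ j) (f' t) x + (- c) * (deriv ^^ j) d x)"
        unfolding e_def by (rule sobolev_deriv_lincomb[OF fs(2) cont' ds r]) (use \<tau> t in auto)
      have 3: "(deriv ^^ j) q = (\<lambda>x. (deriv ^^ j) (\<lambda>x. 0) x + (- 1) * (deriv ^^ j) e x)"
        unfolding q_def by (rule sobolev_deriv_lincomb[OF sobolev_zero _ es r]) simp
      have 4: "(deriv ^^ i) (\<lambda>x. 0 :: real) = (\<lambda>x. 0)" for i
        by (induction i) auto
      show ?thesis by (simp only: 1 2 3 4)
    qed
    then have "((deriv ^^ j) (f \<tau>) x - (deriv ^^ j) (f t) x) / (\<tau> - t) - (deriv ^^ j) (f' t) x = (deriv ^^ j) q x"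
      by (simp add: c_def)
    then show "norm (((deriv ^^ j) (f \<tau>) x - (deriv ^^ j) (f t) x) / (\<tau> - t) - (deriv ^^ j) (f' t) x)
      \<le> embedding_const j r * sobolev_norm r (\<lambda>x. (f \<tau> x - f t x) / (\<tau> - t) - f' t x)"
      using sobolev_deriv(1)[OF qs r, of x] unfolding q[symmetric] by simp
  qed
qed

section \<open>Preservation of symmetry and blow-up for classical solutions\<close>

lemma DERIV_reflect:
  fixes h h' :: "real \<Rightarrow> real"
  assumes "\<And>x. (h has_real_derivative h' x) (at x)"
  shows "((\<lambda>x. h (- x)) has_real_derivative - h' (- x)) (at x)"
  using DERIV_chain2[OF assms[of "- x"] DERIV_minus[OF DERIV_ident]] by simp

lemma tendsto_0_reflect:
  fixes f :: "real \<Rightarrow> real"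
  assumes "(f \<longlongrightarrow> 0) at_infinity"
  shows "((\<lambda>x. f (- x)) \<longlongrightarrow> 0) at_infinity"
  using assms unfolding tendsto_0_at_infinity_iff by (metis abs_minus_cancel)

text \<open>
  The classical content of a global solution: \<open>p\<close> stands for the solution of \<open>p - p'' = f\<close>, so
  that the nonlocal term of the first equation is \<open>px\<close>. The equation \<open>uxt\<close> is the \<open>x\<close>-derivative
  of \<open>ut\<close> with \<open>p''\<close> eliminated.
\<close>

locale classical_b_family =
  fixes k1 k2 k3 :: real and u ux uxx \<rho> \<rho>x p px :: "real \<Rightarrow> real \<Rightarrow> real"
  fixes f :: "real \<Rightarrow> real \<Rightarrow> real"
  defines "f \<equiv> \<lambda>t x. k1 / 2 * (u t x)\<^sup>2 + (3 - k1) / 2 * (ux t x)\<^sup>2 + k2 / 2 * (\<rho> t x)\<^sup>2"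
  assumes ux: "t \<ge> 0 \<Longrightarrow> (u t has_real_derivative ux t x) (at x)"
    and uxx: "t \<ge> 0 \<Longrightarrow> (ux t has_real_derivative uxx t x) (at x)"
    and \<rho>x: "t \<ge> 0 \<Longrightarrow> (\<rho> t has_real_derivative \<rho>x t x) (at x)"
    and px: "t \<ge> 0 \<Longrightarrow> (p t has_real_derivative px t x) (at x)"
    and pxx: "t \<ge> 0 \<Longrightarrow> (px t has_real_derivative p t x - f t x) (at x)"
    and ut: "t \<ge> 0 \<Longrightarrow> ((\<lambda>s. u s x) has_real_derivative u t x * ux t x + px t x) (at t within {0..})"
    and uxt: "t \<ge> 0 \<Longrightarrow> ((\<lambda>s. ux s x) has_real_derivative
        (ux t x)\<^sup>2 + u t x * uxx t x + p t x - f t x) (at t within {0..})"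
    and \<rho>t: "t \<ge> 0 \<Longrightarrow> ((\<lambda>s. \<rho> s x) has_real_derivative
        k3 * (u t x * \<rho>x t x + ux t x * \<rho> t x)) (at t within {0..})"
    and uc: "sup_continuous u" "sup_continuous ux" "sup_continuous \<rho>"
    and lim: "t \<ge> 0 \<Longrightarrow> (u t \<longlongrightarrow> 0) at_infinity" "t \<ge> 0 \<Longrightarrow> (ux t \<longlongrightarrow> 0) at_infinity"
      "t \<ge> 0 \<Longrightarrow> (\<rho> t \<longlongrightarrow> 0) at_infinity" "t \<ge> 0 \<Longrightarrow> (p t \<longlongrightarrow> 0) at_infinity"
    and bdd: "\<exists>M. \<forall>t x. 0 \<le> t \<longrightarrow> t \<le> \<tau> \<longrightarrow>
        \<bar>u t x\<bar> \<le> M \<and> \<bar>ux t x\<bar> \<le> M \<and> \<bar>uxx t x\<bar> \<le> M \<and> \<bar>\<rho> t x\<bar> \<le> M \<and> \<bar>\<rho>x t x\<bar> \<le> M"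
begin

text \<open>
  The deviation from the symmetry \<open>u\<close> odd, \<open>\<rho>\<close> even: the index 0 belongs to \<open>u\<close>, 1 to \<open>ux\<close> and
  every other index to \<open>\<rho>\<close>. The derivative \<open>ux\<close> has to be carried along because it enters the
  source \<open>f\<close>.
\<close>

definition defect :: "real \<Rightarrow> nat \<Rightarrow> real \<Rightarrow> real" where
  "defect t k x = (if k = 0 then u t x + u t (- x)
     else if k = 1 then ux t x - ux t (- x) else \<rho> t x - \<rho> t (- x))"

lemma defect_derivative:
  assumes "t \<ge> 0"
  shows "(defect t k has_real_derivative (if k = 0 then ux t x - ux t (- x)
     else if k = 1 then uxx t x + uxx t (- x) else \<rho>x t x + \<rho>x t (- x))) (at x)"
proof -
  note d = ux[OF assms] uxx[OF assms] \<rho>x[OF assms]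
  have "((\<lambda>x. u t x + u t (- x)) has_real_derivative ux t x + - ux t (- x)) (at x)"
    "((\<lambda>x. ux t x - ux t (- x)) has_real_derivative uxx t x - - uxx t (- x)) (at x)"
    "((\<lambda>x. \<rho> t x - \<rho> t (- x)) has_real_derivative \<rho>x t x - - \<rho>x t (- x)) (at x)"
    by (intro DERIV_add DERIV_diff DERIV_reflect d)+
  then show ?thesis unfolding defect_def[abs_def] by auto
qed

lemma defect_max:
  assumes t: "t \<ge> 0"
  obtains k x where "\<And>j y. \<bar>defect t j y\<bar> \<le> \<bar>defect t k x\<bar>"
proof -
  have "\<exists>x. \<forall>y. \<bar>defect t k y\<bar> \<le> \<bar>defect t k x\<bar>" for k
  proof -
    have "continuous_on UNIV (defect t k)"
      using defect_derivative[OF t] by (meson DERIV_isCont continuous_at_imp_continuous_on)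
    moreover have "(defect t k \<longlongrightarrow> 0) at_infinity"
    proof -
      note l = lim(1-3)[OF t]
      have "((\<lambda>x. u t x + u t (- x)) \<longlongrightarrow> 0 + 0) at_infinity"
        "((\<lambda>x. ux t x - ux t (- x)) \<longlongrightarrow> 0 - 0) at_infinity"
        "((\<lambda>x. \<rho> t x - \<rho> t (- x)) \<longlongrightarrow> 0 - 0) at_infinity"
        by (intro tendsto_add tendsto_diff tendsto_0_reflect l)+
      then show ?thesis
        by (cases "k = 0"; cases "k = 1") (simp_all add: defect_def[abs_def])
    qed
    ultimately show ?thesis using attains_max_abs by metis
  qed
  then obtain x where x: "\<And>k y. \<bar>defect t k y\<bar> \<le> \<bar>defect t k (x k)\<bar>" by metis
  define N where "N = (\<lambda>j. \<bar>defect t j (x j)\<bar>)"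
  have "Max (N ` {0, 1, 2}) \<in> N ` {0, 1, 2}" by (rule Max_in) auto
  then obtain k where "Max (N ` {0, 1, 2}) = N k" by blast
  then have k: "N j \<le> N k" if "j \<in> {0, 1, 2}" for j :: nat
    using Max_ge[of "N ` {0, 1, 2}" "N j"] that by auto
  show ?thesis
  proof (rule that)
    fix j y
    \<comment> \<open>All indices from 2 on belong to \<open>\<rho>\<close>, so three maxima suffice.\<close>
    define i :: nat where "i = min j 2"
    have "i \<in> {0, 1, 2}" by (auto simp: i_def)
    moreover have "defect t j y = defect t i y" by (auto simp: defect_def i_def)
    ultimately show "\<bar>defect t j y\<bar> \<le> \<bar>defect t k (x k)\<bar>"
      using k[of i] x[of i y] by (simp add: N_def)
  qed
qed

text \<open>
  Each equation, minus its reflection, is linear in the defects with bounded coefficients,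
  except for the transport terms \<open>u * uxx\<close> and \<open>u * \<rho>x\<close>. At a maximum of the defect these
  contribute \<open>u\<close> times the space derivative of the defect, which is zero. The nonlocal terms
  are controlled by the maximum principle for the odd part of \<open>p\<close>.
\<close>

lemma defect_time_derivative:
  assumes t: "0 \<le> t" "t \<le> \<tau>" and M: "\<And>t x. 0 \<le> t \<Longrightarrow> t \<le> \<tau> \<Longrightarrow>
        \<bar>u t x\<bar> \<le> M \<and> \<bar>ux t x\<bar> \<le> M \<and> \<bar>uxx t x\<bar> \<le> M \<and> \<bar>\<rho> t x\<bar> \<le> M \<and> \<bar>\<rho>x t x\<bar> \<le> M"
    and max: "\<And>j y. \<bar>defect t j y\<bar> \<le> \<bar>defect t k x\<bar>"
  shows "\<exists>d. ((\<lambda>s. defect s k x) has_real_derivative d) (at t within {0..}) \<and>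
     \<bar>d\<bar> \<le> (5 + 4 * (\<bar>k1\<bar> + \<bar>3 - k1\<bar> + \<bar>k2\<bar>) + 3 * \<bar>k3\<bar>) * M * \<bar>defect t k x\<bar>"
proof -
  define B where "B = \<bar>defect t k x\<bar>"
  define K where "K = \<bar>k1\<bar> + \<bar>3 - k1\<bar> + \<bar>k2\<bar>"
  have K0: "K \<ge> 0" and B0: "B \<ge> 0" by (auto simp: K_def B_def)
  note M' = M[OF t]
  have M0: "M \<ge> 0" using M'[of 0] by linarith
  have MB: "M * B \<ge> 0" using M0 B0 by simp
  have KMB: "K * (M * B) \<ge> 0" and k3MB: "\<bar>k3\<bar> * (M * B) \<ge> 0" using K0 MB by auto
  have w: "\<bar>u t y + u t (- y)\<bar> \<le> B" for y using max[of 0 y] by (simp add: defect_def B_def)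
  have wx: "\<bar>ux t y - ux t (- y)\<bar> \<le> B" for y using max[of 1 y] by (simp add: defect_def B_def)
  have s: "\<bar>\<rho> t y - \<rho> t (- y)\<bar> \<le> B" for y using max[of 2 y] by (simp add: defect_def B_def)
  have uM: "\<bar>u t y\<bar> \<le> M" and uxM: "\<bar>ux t y\<bar> \<le> M" and uxxM: "\<bar>uxx t y\<bar> \<le> M"
    and \<rho>M: "\<bar>\<rho> t y\<bar> \<le> M" and \<rho>xM: "\<bar>\<rho>x t y\<bar> \<le> M" for y
    using M'[of y] by blast+
  have two: "\<bar>a + b\<bar> \<le> 2 * M" "\<bar>a - b\<bar> \<le> 2 * M" if "\<bar>a\<bar> \<le> M" "\<bar>b\<bar> \<le> M" for a b
    using that by linarith+
  have prod: "\<bar>a * b\<bar> \<le> c * d" if "\<bar>a\<bar> \<le> c" "\<bar>b\<bar> \<le> d" for a b c d :: real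
    unfolding abs_mult by (rule mult_mono) (use that in auto)
  have F: "\<bar>f t y - f t (- y)\<bar> \<le> K * (M * B)" for y
  proof -
    have a: "\<bar>(u t y - u t (- y)) * (u t y + u t (- y))\<bar> \<le> (2 * M) * B"
      "\<bar>(ux t y + ux t (- y)) * (ux t y - ux t (- y))\<bar> \<le> (2 * M) * B"
      "\<bar>(\<rho> t y + \<rho> t (- y)) * (\<rho> t y - \<rho> t (- y))\<bar> \<le> (2 * M) * B"
      by (intro prod two uM uxM \<rho>M w wx s)+
    have "f t y - f t (- y) = k1 / 2 * ((u t y - u t (- y)) * (u t y + u t (- y)))
        + (3 - k1) / 2 * ((ux t y + ux t (- y)) * (ux t y - ux t (- y)))
        + k2 / 2 * ((\<rho> t y + \<rho> t (- y)) * (\<rho> t y - \<rho> t (- y)))"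
      by (simp add: f_def field_simps power2_eq_square)
    also have "\<bar>\<dots>\<bar> \<le> \<bar>k1 / 2\<bar> * ((2 * M) * B) + \<bar>(3 - k1) / 2\<bar> * ((2 * M) * B) + \<bar>k2 / 2\<bar> * ((2 * M) * B)"
      by (intro order_trans[OF abs_triangle_ineq] add_mono) (use a in \<open>simp_all only: abs_mult mult_left_mono abs_ge_zero\<close>)
    also have "\<dots> = K * (M * B)" by (simp add: K_def field_simps)
    finally show ?thesis .
  qed
  have P: "\<bar>p t x - p t (- x)\<bar> \<le> K * (M * B)" "\<bar>px t x + px t (- x)\<bar> \<le> 4 * (K * (M * B))"
  proof -
    have d: "((\<lambda>y. p t y - p t (- y)) has_real_derivative px t y + px t (- y)) (at y)"
      "((\<lambda>y. px t y + px t (- y)) has_real_derivative (p t y - f t y) - (p t (- y) - f t (- y))) (at y)" for y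
      using DERIV_diff[OF px[OF t(1)] DERIV_reflect[OF px[OF t(1)]], of y]
        DERIV_add[OF pxx[OF t(1)] DERIV_reflect[OF pxx[OF t(1)]], of y] by (simp_all add: algebra_simps)
    have l: "((\<lambda>y. p t y - p t (- y)) \<longlongrightarrow> 0) at_infinity"
      using tendsto_diff[OF lim(4)[OF t(1)] tendsto_0_reflect[OF lim(4)[OF t(1)]]] by simp
    have b: "\<bar>(p t y - p t (- y)) - ((p t y - f t y) - (p t (- y) - f t (- y)))\<bar> \<le> K * (M * B)" for y
      using F[of y] by (simp add: algebra_simps)
    show "\<bar>p t x - p t (- x)\<bar> \<le> K * (M * B)" "\<bar>px t x + px t (- x)\<bar> \<le> 4 * (K * (M * B))"
      using helmholtz_bounds[OF d l b] by auto
  qed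
  have crit: "(if k = 0 then ux t x - ux t (- x)
     else if k = 1 then uxx t x + uxx t (- x) else \<rho>x t x + \<rho>x t (- x)) = 0" (is "?D = 0")
  proof (cases "defect t k x \<ge> 0")
    case True
    show ?thesis
      by (rule DERIV_local_max[OF defect_derivative[OF t(1), of k x], of 1])
        (use max[of k] True in \<open>auto simp: abs_le_iff\<close>)
  next
    case False
    show ?thesis
      by (rule DERIV_local_min[OF defect_derivative[OF t(1), of k x], of 1])
        (use max[of k] False in \<open>force simp: abs_le_iff\<close>)+
  qed
  have goal: "\<bar>d\<bar> \<le> (5 + 4 * K + 3 * \<bar>k3\<bar>) * M * B"
    if "\<bar>d\<bar> \<le> 5 * (M * B) + 4 * (K * (M * B)) + 3 * (\<bar>k3\<bar> * (M * B))" for d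
    using that by (simp add: algebra_simps)
  consider "k = 0" | "k = 1" | "k \<ge> 2" by linarith
  then show ?thesis
    unfolding B_def[symmetric] K_def[symmetric]
  proof cases
    case 1
    define d where "d = u t x * (ux t x - ux t (- x)) + (u t x + u t (- x)) * ux t (- x) + (px t x + px t (- x))"
    have "((\<lambda>s. defect s k x) has_real_derivative d) (at t within {0..})"
      using DERIV_add[OF ut[OF t(1), of x] ut[OF t(1), of "- x"]] 1
      by (simp add: defect_def d_def algebra_simps)
    moreover have "\<bar>u t x * (ux t x - ux t (- x))\<bar> \<le> M * B" "\<bar>(u t x + u t (- x)) * ux t (- x)\<bar> \<le> B * M"
      by (intro prod two uM uxM uxxM w wx)+
    then have "\<bar>d\<bar> \<le> 5 * (M * B) + 4 * (K * (M * B)) + 3 * (\<bar>k3\<bar> * (M * B))"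
      unfolding d_def mult.commute[of B M] using P(2) KMB k3MB MB by linarith
    ultimately show "\<exists>d. ((\<lambda>s. defect s k x) has_real_derivative d) (at t within {0..}) \<and>
      \<bar>d\<bar> \<le> (5 + 4 * K + 3 * \<bar>k3\<bar>) * M * B" using goal by blast
  next
    case 2
    define d where "d = (ux t x + ux t (- x)) * (ux t x - ux t (- x)) - (u t x + u t (- x)) * uxx t (- x)
      + (p t x - p t (- x)) - (f t x - f t (- x))"
    \<comment> \<open>This cancels the transport term \<open>u * uxx\<close> against the reflected one.\<close>
    have xx: "uxx t x = - uxx t (- x)" using crit 2 by simp
    have "((\<lambda>s. defect s k x) has_real_derivative d) (at t within {0..})"
      using DERIV_diff[OF uxt[OF t(1), of x] uxt[OF t(1), of "- x"]] 2
      by (simp add: defect_def d_def algebra_simps power2_eq_square xx)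
    moreover have "\<bar>(ux t x + ux t (- x)) * (ux t x - ux t (- x))\<bar> \<le> (2 * M) * B"
      "\<bar>(u t x + u t (- x)) * uxx t (- x)\<bar> \<le> B * M"
      by (intro prod two uM uxM uxxM w wx)+
    then have "\<bar>d\<bar> \<le> 5 * (M * B) + 4 * (K * (M * B)) + 3 * (\<bar>k3\<bar> * (M * B))"
      unfolding d_def mult.commute[of B M] mult.assoc using P(1) F[of x] KMB k3MB MB by linarith
    ultimately show "\<exists>d. ((\<lambda>s. defect s k x) has_real_derivative d) (at t within {0..}) \<and>
      \<bar>d\<bar> \<le> (5 + 4 * K + 3 * \<bar>k3\<bar>) * M * B" using goal by blast
  next
    case 3
    define e where "e = ux t x * (\<rho> t x - \<rho> t (- x)) + (ux t x - ux t (- x)) * \<rho> t (- x)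
      - (u t x + u t (- x)) * \<rho>x t (- x)"
    have xx: "\<rho>x t x = - \<rho>x t (- x)" using crit 3 by simp
    have "((\<lambda>s. defect s k x) has_real_derivative k3 * e) (at t within {0..})"
      using DERIV_diff[OF \<rho>t[OF t(1), of x] \<rho>t[OF t(1), of "- x"]] 3
      by (simp add: defect_def e_def algebra_simps xx)
    moreover have "\<bar>ux t x * (\<rho> t x - \<rho> t (- x))\<bar> \<le> M * B"
      "\<bar>(ux t x - ux t (- x)) * \<rho> t (- x)\<bar> \<le> B * M" "\<bar>(u t x + u t (- x)) * \<rho>x t (- x)\<bar> \<le> B * M"
      by (intro prod uM uxM \<rho>M \<rho>xM w wx s)+
    then have "\<bar>e\<bar> \<le> 3 * (M * B)"
      unfolding e_def mult.commute[of B M] by linarith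
    then have "\<bar>k3 * e\<bar> \<le> 3 * (\<bar>k3\<bar> * (M * B))"
      unfolding abs_mult using mult_left_mono[of "\<bar>e\<bar>" "3 * (M * B)" "\<bar>k3\<bar>"] by simp
    then have "\<bar>k3 * e\<bar> \<le> 5 * (M * B) + 4 * (K * (M * B)) + 3 * (\<bar>k3\<bar> * (M * B))"
      using KMB MB by linarith
    ultimately show "\<exists>d. ((\<lambda>s. defect s k x) has_real_derivative d) (at t within {0..}) \<and>
      \<bar>d\<bar> \<le> (5 + 4 * K + 3 * \<bar>k3\<bar>) * M * B" using goal by blast
  qed
qed

lemma sup_continuous_defect:
  "sup_continuous (\<lambda>t (e, k, x). (if e then 1 else - 1) * defect t k x)"
  unfolding sup_continuous_def
proof (intro allI impI)
  fix t \<epsilon> :: real assume t: "t \<ge> 0" and \<epsilon>: "\<epsilon> > 0"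
  then have e2: "\<epsilon> / 2 > 0" by simp
  obtain \<delta>1 where d1: "\<delta>1 > 0" "\<And>s x. s \<ge> 0 \<Longrightarrow> \<bar>s - t\<bar> < \<delta>1 \<Longrightarrow> \<bar>u s x - u t x\<bar> \<le> \<epsilon> / 2"
    using sup_continuousD[OF uc(1) t e2] by blast
  obtain \<delta>2 where d2: "\<delta>2 > 0" "\<And>s x. s \<ge> 0 \<Longrightarrow> \<bar>s - t\<bar> < \<delta>2 \<Longrightarrow> \<bar>ux s x - ux t x\<bar> \<le> \<epsilon> / 2"
    using sup_continuousD[OF uc(2) t e2] by blast
  obtain \<delta>3 where d3: "\<delta>3 > 0" "\<And>s x. s \<ge> 0 \<Longrightarrow> \<bar>s - t\<bar> < \<delta>3 \<Longrightarrow> \<bar>\<rho> s x - \<rho> t x\<bar> \<le> \<epsilon> / 2"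
    using sup_continuousD[OF uc(3) t e2] by blast
  define \<delta> where "\<delta> = min \<delta>1 (min \<delta>2 \<delta>3)"
  have d: "\<bar>defect s k x - defect t k x\<bar> \<le> \<epsilon>" if "s \<ge> 0" "\<bar>s - t\<bar> < \<delta>" for s k x
  proof -
    have b: "\<bar>u s y - u t y\<bar> \<le> \<epsilon> / 2" "\<bar>ux s y - ux t y\<bar> \<le> \<epsilon> / 2" "\<bar>\<rho> s y - \<rho> t y\<bar> \<le> \<epsilon> / 2" for y
      using that d1(2)[of s y] d2(2)[of s y] d3(2)[of s y] by (auto simp: \<delta>_def)
    have "\<bar>(u s x + u s (- x)) - (u t x + u t (- x))\<bar> \<le> \<epsilon>"
      using b(1)[of x] b(1)[of "- x"] by linarith
    moreover have "\<bar>(ux s x - ux s (- x)) - (ux t x - ux t (- x))\<bar> \<le> \<epsilon>"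
      using b(2)[of x] b(2)[of "- x"] by linarith
    moreover have "\<bar>(\<rho> s x - \<rho> s (- x)) - (\<rho> t x - \<rho> t (- x))\<bar> \<le> \<epsilon>"
      using b(3)[of x] b(3)[of "- x"] by linarith
    ultimately show ?thesis unfolding defect_def by simp
  qed
  have "\<bar>(if e then 1 else - 1) * defect s k x - (if e then 1 else - 1) * defect t k x\<bar> \<le> \<epsilon>"
    if "s \<ge> 0" "\<bar>s - t\<bar> < \<delta>" for s k x and e :: bool
    using d[OF that, of k x] by (cases e) (simp_all add: abs_minus_commute)
  moreover have "\<delta> > 0" using d1 d2 d3 by (simp add: \<delta>_def)
  ultimately show "\<exists>\<delta>>0. \<forall>\<tau>\<ge>0. \<bar>\<tau> - t\<bar> < \<delta> \<longrightarrow>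
     (\<forall>i. \<bar>(case i of (e, k, x) \<Rightarrow> (if e then 1 else - 1) * defect \<tau> k x)
        - (case i of (e, k, x) \<Rightarrow> (if e then 1 else - 1) * defect t k x)\<bar> \<le> \<epsilon>)"
    by (intro exI[of _ \<delta>]) (simp only: split_paired_All prod.case, blast)
qed

text \<open>
  The reflected pair \<open>(- u t (- x), \<rho> t (- x))\<close> solves the same equations, so this is a uniqueness
  statement; it is proved directly for the defects of a single solution.
\<close>

lemma symmetry_preserved:
  assumes odd: "\<And>x. u 0 (- x) = - u 0 x" and even: "\<And>x. \<rho> 0 (- x) = \<rho> 0 x" and t: "t \<ge> 0"
  shows "u t (- x) = - u t x" and "\<rho> t (- x) = \<rho> t x"
proof -
  obtain M where M: "\<And>s x. 0 \<le> s \<Longrightarrow> s \<le> t \<Longrightarrow>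
        \<bar>u s x\<bar> \<le> M \<and> \<bar>ux s x\<bar> \<le> M \<and> \<bar>uxx s x\<bar> \<le> M \<and> \<bar>\<rho> s x\<bar> \<le> M \<and> \<bar>\<rho>x s x\<bar> \<le> M"
    using bdd[of t] by blast
  have M0: "M \<ge> 0" using M[of 0 0] t by linarith
  define C where "C = (5 + 4 * (\<bar>k1\<bar> + \<bar>3 - k1\<bar> + \<bar>k2\<bar>) + 3 * \<bar>k3\<bar>) * M"
  have C0: "C \<ge> 0" using M0 by (simp add: C_def)
  define \<phi> where "\<phi> = (\<lambda>t (e, k, x). (if e then 1 else - 1) * defect t k x)"
  have init: "\<phi> 0 i \<le> 0" for i
  proof -
    have w0: "defect 0 0 = (\<lambda>x. 0)" by (auto simp: defect_def odd)
    have "ux 0 x - ux 0 (- x) = 0" for x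
      using DERIV_unique[OF defect_derivative[of 0 0 x, OF order_refl, unfolded w0] DERIV_const] by simp
    then have "defect 0 k x = 0" for k x
      using w0 by (simp add: defect_def even odd)
    then show ?thesis by (cases i) (simp add: \<phi>_def)
  qed
  have nonpos: "\<phi> t i \<le> 0" for i
  proof (rule gronwall_maximum_principle[where \<phi> = \<phi> and \<tau> = t and C = C])
    show "sup_continuous \<phi>" unfolding \<phi>_def by (rule sup_continuous_defect)
    show "\<exists>i. \<forall>j. \<phi> s j \<le> \<phi> s i" if s: "0 \<le> s" for s
    proof -
      obtain k x where m: "\<And>j y. \<bar>defect s j y\<bar> \<le> \<bar>defect s k x\<bar>" using defect_max[OF s] by blast
      have "\<phi> s j \<le> \<phi> s (0 \<le> defect s k x, k, x)" for j
      proof (cases j)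
        case (fields e k' y)
        then show ?thesis using m[of k' y] by (simp add: \<phi>_def abs_le_iff) linarith
      qed
      then show ?thesis by blast
    qed
    show "\<exists>d. ((\<lambda>s. \<phi> s i) has_real_derivative d) (at s within {0..}) \<and> d \<le> C * \<phi> s i"
      if s: "0 \<le> s" "s \<le> t" and pos: "\<phi> s i > 0" and max: "\<And>j. \<phi> s j \<le> \<phi> s i" for s i
    proof -
      obtain e k x where i: "i = (e, k, x)" by (cases i)
      have eq: "\<phi> s i = \<bar>defect s k x\<bar>"
        using pos by (auto simp: \<phi>_def i split: if_splits)
      have "\<bar>defect s j y\<bar> \<le> \<bar>defect s k x\<bar>" for j y
        using max[of "(0 \<le> defect s j y, j, y)"] unfolding eq by (simp add: \<phi>_def split: if_splits)
      then obtain d where d: "((\<lambda>s. defect s k x) has_real_derivative d) (at s within {0..})"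
        "\<bar>d\<bar> \<le> C * \<bar>defect s k x\<bar>"
        using defect_time_derivative[OF s M] unfolding C_def by blast
      have "((\<lambda>s. \<phi> s i) has_real_derivative (if e then 1 else - 1) * d) (at s within {0..})"
        unfolding \<phi>_def i prod.case by (rule DERIV_cmult[OF d(1)])
      moreover have "(if e then 1 else - 1) * d \<le> C * \<phi> s i"
        using d(2) unfolding eq by (auto simp: abs_le_iff)
      ultimately show ?thesis by blast
    qed
  qed (use init C0 t in auto)
  have "defect t k x = 0" for k
    using nonpos[of "(True, k, x)"] nonpos[of "(False, k, x)"] by (simp add: \<phi>_def)
  from this[of 0] this[of 2] show "u t (- x) = - u t x" "\<rho> t (- x) = \<rho> t x"
    by (auto simp: defect_def)
qed

text \<open>
  At the origin the transport term vanishes with \<open>u\<close>, which leaves a linear ordinary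
  differential equation.
\<close>

lemma density_vanishes_at_origin:
  assumes u0: "\<And>t. t \<ge> 0 \<Longrightarrow> u t 0 = 0" and \<rho>0: "\<rho> 0 0 = 0" and t: "t \<ge> 0"
  shows "\<rho> t 0 = 0"
proof -
  obtain M where M: "\<And>s x. 0 \<le> s \<Longrightarrow> s \<le> t \<Longrightarrow>
        \<bar>u s x\<bar> \<le> M \<and> \<bar>ux s x\<bar> \<le> M \<and> \<bar>uxx s x\<bar> \<le> M \<and> \<bar>\<rho> s x\<bar> \<le> M \<and> \<bar>\<rho>x s x\<bar> \<le> M"
    using bdd[of t] by blast
  have M0: "M \<ge> 0" using M[of 0 0] t by linarith
  define \<phi> where "\<phi> = (\<lambda>t e. (if e then 1 else - 1) * \<rho> t 0)"
  have nonpos: "\<phi> t e \<le> 0" for e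
  proof (rule gronwall_maximum_principle[where \<phi> = \<phi> and \<tau> = t and C = "\<bar>k3\<bar> * M"])
    show "sup_continuous \<phi>"
      using uc(3) unfolding sup_continuous_def \<phi>_def
      by (simp add: abs_minus_commute) meson
    show "\<exists>i. \<forall>j. \<phi> s j \<le> \<phi> s i" for s
    proof -
      have "\<phi> s j \<le> \<phi> s (0 \<le> \<rho> s 0)" for j by (simp add: \<phi>_def)
      then show ?thesis by blast
    qed
    show "\<exists>d. ((\<lambda>s. \<phi> s e) has_real_derivative d) (at s within {0..}) \<and> d \<le> \<bar>k3\<bar> * M * \<phi> s e"
      if s: "0 \<le> s" "s \<le> t" and pos: "\<phi> s e > 0" for s e
    proof -
      have "((\<lambda>s. \<phi> s e) has_real_derivative (if e then 1 else - 1) * (k3 * (u s 0 * \<rho>x s 0 + ux s 0 * \<rho> s 0)))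
          (at s within {0..})"
        unfolding \<phi>_def by (rule DERIV_cmult[OF \<rho>t[OF s(1)]])
      moreover have "(if e then 1 else - 1) * (k3 * (u s 0 * \<rho>x s 0 + ux s 0 * \<rho> s 0)) = (k3 * ux s 0) * \<phi> s e"
        by (simp add: \<phi>_def u0[OF s(1)])
      moreover have "(k3 * ux s 0) * \<phi> s e \<le> (\<bar>k3\<bar> * M) * \<phi> s e"
      proof (rule mult_right_mono)
        have "k3 * ux s 0 \<le> \<bar>k3\<bar> * \<bar>ux s 0\<bar>" by (metis abs_ge_self abs_mult)
        also have "\<dots> \<le> \<bar>k3\<bar> * M" using M[OF s, of 0] by (intro mult_left_mono) auto
        finally show "k3 * ux s 0 \<le> \<bar>k3\<bar> * M" .
      qed (use pos in simp)
      ultimately show ?thesis by force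
    qed
  qed (use \<rho>0 M0 t in \<open>auto simp: \<phi>_def\<close>)
  show ?thesis using nonpos[of True] nonpos[of False] by (simp add: \<phi>_def)
qed

text \<open>
  At the origin \<open>u\<close> and \<open>\<rho>\<close> vanish, so the slope \<open>g = ux t 0\<close> satisfies the Riccati equation
  \<open>g' = (k1 - 1) / 2 * g\<^sup>2 + p t 0\<close>. Here \<open>p \<ge> 0\<close> since \<open>f \<ge> 0\<close>, and \<open>p 0 0 > 0\<close> by the strong
  minimum principle: otherwise \<open>p 0\<close> and with it \<open>f 0\<close> would vanish identically.
\<close>

theorem no_global_symmetric_solution:
  assumes k: "1 < k1" "k1 \<le> 3" "k2 > 0"
    and odd: "\<And>x. u 0 (- x) = - u 0 x" and even: "\<And>x. \<rho> 0 (- x) = \<rho> 0 x"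
    and \<rho>0: "\<rho> 0 0 = 0" and ux0: "ux 0 0 = 0"
    and nontrivial: "u 0 \<noteq> (\<lambda>x. 0) \<or> \<rho> 0 \<noteq> (\<lambda>x. 0)"
  shows False
proof (rule riccati_blow_up[where g = "\<lambda>t. ux t 0" and q = "\<lambda>t. p t 0" and c = "(k1 - 1) / 2"])
  have u0: "u t 0 = 0" if "t \<ge> 0" for t
    using symmetry_preserved(1)[OF odd even that, of 0] by simp
  have f0: "f t x \<ge> 0" for t x
    using k by (simp add: f_def)
  show p0: "p t 0 \<ge> 0" if "t \<ge> 0" for t
    by (rule helmholtz_nonneg[OF px[OF that] pxx[OF that] lim(4)[OF that]]) (simp add: f0)
  show "((\<lambda>t. ux t 0) has_real_derivative (k1 - 1) / 2 * (ux t 0)\<^sup>2 + p t 0) (at t within {0..})"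
    if t: "t \<ge> 0" for t
    using uxt[OF t, of 0] u0[OF t] density_vanishes_at_origin[OF u0 \<rho>0 t]
    by (simp add: f_def field_simps)
  show "p 0 0 > 0"
  proof (rule ccontr)
    assume "\<not> p 0 0 > 0"
    then have 0: "p 0 0 = 0" using p0[of 0] by simp
    have p_ge: "p 0 x \<ge> 0" for x
      by (rule helmholtz_nonneg[OF px pxx lim(4)]) (auto simp: f0)
    have p: "p 0 x = 0" for x
      by (rule helmholtz_strong_minimum[OF px pxx p_ge _ 0]) (auto simp: f0)
    then have p_zero: "p 0 = (\<lambda>x. 0)" by auto
    have "px 0 x = 0" for x
      by (rule DERIV_unique[OF px[of 0 x, OF order_refl, unfolded p_zero] DERIV_const])
    then have px_zero: "px 0 = (\<lambda>x. 0)" by auto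
    have "f 0 x = 0" for x
      using DERIV_unique[OF pxx[of 0 x, OF order_refl, unfolded px_zero] DERIV_const] p[of x] by simp
    moreover have "k1 / 2 * (u 0 x)\<^sup>2 \<ge> 0" "(3 - k1) / 2 * (ux 0 x)\<^sup>2 \<ge> 0" "k2 / 2 * (\<rho> 0 x)\<^sup>2 \<ge> 0" for x
      using k by auto
    ultimately have "k1 / 2 * (u 0 x)\<^sup>2 = 0" "k2 / 2 * (\<rho> 0 x)\<^sup>2 = 0" for x
      unfolding f_def by (smt (verit))+
    then have "u 0 x = 0" "\<rho> 0 x = 0" for x using k by auto
    then show False using nontrivial by auto
  qed
qed (use k ux0 in auto)

end

text \<open>
  For \<open>s > 5 / 2\<close> the embedding applies to two derivatives of \<open>u\<close>, one of \<open>\<rho>\<close> and two of \<open>p\<close>. The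
  time derivatives are continuous in \<open>x\<close> by the equations themselves, so that their pointwise values
  are those of the continuous representatives.
\<close>

lemma global_solution_classical:
  assumes s: "s > 5 / 2" and sol: "b_family_solution k1 k2 k3 s u0 \<rho>0 \<infinity> u \<rho>"
  shows "\<exists>p. classical_b_family k1 k2 k3 u (\<lambda>t. deriv (u t)) (\<lambda>t. deriv (deriv (u t))) \<rho>
    (\<lambda>t. deriv (\<rho> t)) p (\<lambda>t. deriv (p t))"
proof -
  have C0: "sobolev_C0 \<infinity> s u" "sobolev_C0 \<infinity> (s - 1) \<rho>"
    and cont: "\<And>t. t \<ge> 0 \<Longrightarrow> continuous_on UNIV (u t)" "\<And>t. t \<ge> 0 \<Longrightarrow> continuous_on UNIV (\<rho> t)"
    using sol unfolding b_family_solution_def time_interval_infinity by auto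
  obtain u' \<rho>' p where C1: "sobolev_C1 \<infinity> (s - 1) u u'" "sobolev_C1 \<infinity> (s - 2) \<rho> \<rho>'"
    and eqs: "\<forall>t\<in>{0..}. inverse_helmholtz (s - 1)
             (\<lambda>x. k1 / 2 * (u t x)\<^sup>2 + (3 - k1) / 2 * (deriv (u t) x)\<^sup>2 + k2 / 2 * (\<rho> t x)\<^sup>2) (p t) \<and>
        (\<forall>x. u' t x - u t x * deriv (u t) x = deriv (p t) x) \<and>
        (\<forall>x. \<rho>' t x - k3 * u t x * deriv (\<rho> t) x = k3 * deriv (u t) x * \<rho> t x)"
    using sol unfolding b_family_solution_def time_interval_infinity by (elim conjE exE)
  have H: "inverse_helmholtz (s - 1)
             (\<lambda>x. k1 / 2 * (u t x)\<^sup>2 + (3 - k1) / 2 * (deriv (u t) x)\<^sup>2 + k2 / 2 * (\<rho> t x)\<^sup>2) (p t)"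
    and u'_eq: "\<And>x. u' t x - u t x * deriv (u t) x = deriv (p t) x"
    and \<rho>'_eq: "\<And>x. \<rho>' t x - k3 * u t x * deriv (\<rho> t) x = k3 * deriv (u t) x * \<rho> t x"
    if "t \<ge> 0" for t
    using eqs that by blast+
  have us: "u t \<in> sobolev s" and \<rho>s: "\<rho> t \<in> sobolev (s - 1)" if "t \<ge> 0" for t
    using C0 that by (auto simp: sobolev_C0_def time_interval_infinity)
  have ps: "p t \<in> sobolev (s + 1)" and pc: "continuous_on UNIV (p t)"
    and p_eq: "\<And>x. p t x - deriv (deriv (p t)) x =
      k1 / 2 * (u t x)\<^sup>2 + (3 - k1) / 2 * (deriv (u t) x)\<^sup>2 + k2 / 2 * (\<rho> t x)\<^sup>2" if "t \<ge> 0" for t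
  proof -
    have "s - 1 + 2 = s + 1" by simp
    from H[OF that, unfolded inverse_helmholtz_def this]
    show "p t \<in> sobolev (s + 1)" "continuous_on UNIV (p t)" "\<And>x. p t x - deriv (deriv (p t)) x =
      k1 / 2 * (u t x)\<^sup>2 + (3 - k1) / 2 * (deriv (u t) x)\<^sup>2 + k2 / 2 * (\<rho> t x)\<^sup>2"
      by blast+
  qed
  have ux: "(u t has_real_derivative deriv (u t) x) (at x)"
    and uxx: "(deriv (u t) has_real_derivative deriv (deriv (u t)) x) (at x)" if "t \<ge> 0" for t x
    using sobolev_deriv(3)[OF us[OF that] cont(1)[OF that], of 0]
      sobolev_deriv(3)[OF us[OF that] cont(1)[OF that], of 1] s by simp_all
  have \<rho>x: "(\<rho> t has_real_derivative deriv (\<rho> t) x) (at x)"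
    and \<rho>xc: "continuous_on UNIV (deriv (\<rho> t))" if "t \<ge> 0" for t x
    using sobolev_deriv(3)[OF \<rho>s[OF that] cont(2)[OF that], of 0]
      sobolev_deriv(2)[OF \<rho>s[OF that] cont(2)[OF that], of 1] s by simp_all
  have px: "(p t has_real_derivative deriv (p t) x) (at x)"
    and pxx: "(deriv (p t) has_real_derivative deriv (deriv (p t)) x) (at x)" if "t \<ge> 0" for t x
    using sobolev_deriv(3)[OF ps[OF that] pc[OF that], of 0]
      sobolev_deriv(3)[OF ps[OF that] pc[OF that], of 1] s by simp_all
  have DERIV_cont: "continuous_on UNIV h" if "\<And>x. (h has_real_derivative h' x) (at x)" for h h' :: "real \<Rightarrow> real"
    using that by (meson DERIV_isCont continuous_at_imp_continuous_on)
  have u': "u' t = (\<lambda>x. u t x * deriv (u t) x + deriv (p t) x)" if "t \<ge> 0" for t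
    using u'_eq[OF that] by (auto simp: algebra_simps)
  have \<rho>': "\<rho>' t = (\<lambda>x. k3 * (u t x * deriv (\<rho> t) x + deriv (u t) x * \<rho> t x))" if "t \<ge> 0" for t
    using \<rho>'_eq[OF that] by (auto simp: algebra_simps)
  have u'c: "continuous_on UNIV (u' t)" if "t \<ge> 0" for t
    unfolding u'[OF that]
    by (intro continuous_intros DERIV_cont[OF ux[OF that]] DERIV_cont[OF uxx[OF that]] DERIV_cont[OF pxx[OF that]])
  have \<rho>'c: "continuous_on UNIV (\<rho>' t)" if "t \<ge> 0" for t
    unfolding \<rho>'[OF that]
    by (intro continuous_intros cont \<rho>xc DERIV_cont[OF uxx[OF that]] that)
  have u'x: "deriv (u' t) x = (deriv (u t) x)\<^sup>2 + u t x * deriv (deriv (u t)) x + deriv (deriv (p t)) x"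
    if "t \<ge> 0" for t x
  proof (rule DERIV_imp_deriv)
    show "(u' t has_real_derivative (deriv (u t) x)\<^sup>2 + u t x * deriv (deriv (u t)) x + deriv (deriv (p t)) x) (at x)"
      unfolding u'[OF that]
      by (rule derivative_eq_intros ux[OF that] uxx[OF that] pxx[OF that] refl)+
        (simp add: power2_eq_square)
  qed
  have "classical_b_family k1 k2 k3 u (\<lambda>t. deriv (u t)) (\<lambda>t. deriv (deriv (u t))) \<rho>
    (\<lambda>t. deriv (\<rho> t)) p (\<lambda>t. deriv (p t))"
  proof
    fix t x :: real assume t: "t \<ge> 0"
    show "(u t has_real_derivative deriv (u t) x) (at x)"
      "(deriv (u t) has_real_derivative deriv (deriv (u t)) x) (at x)"
      "(\<rho> t has_real_derivative deriv (\<rho> t) x) (at x)"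
      "(p t has_real_derivative deriv (p t) x) (at x)"
      by (intro ux uxx \<rho>x px t)+
    show "(deriv (p t) has_real_derivative p t x -
        (k1 / 2 * (u t x)\<^sup>2 + (3 - k1) / 2 * (deriv (u t) x)\<^sup>2 + k2 / 2 * (\<rho> t x)\<^sup>2)) (at x)"
      using pxx[OF t, of x] by (simp only: p_eq[OF t, of x, symmetric]) simp
    show "((\<lambda>s. u s x) has_real_derivative u t x * deriv (u t) x + deriv (p t) x) (at t within {0..})"
      using sobolev_C1_time_derivative[OF C1(1) cont(1) u'c _ t, of 0 x] s u'[OF t] by simp
    show "((\<lambda>s. deriv (u s) x) has_real_derivative (deriv (u t) x)\<^sup>2 + u t x * deriv (deriv (u t)) x + p t x -
        (k1 / 2 * (u t x)\<^sup>2 + (3 - k1) / 2 * (deriv (u t) x)\<^sup>2 + k2 / 2 * (\<rho> t x)\<^sup>2)) (at t within {0..})"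
      unfolding p_eq[OF t, of x, symmetric]
      using sobolev_C1_time_derivative[OF C1(1) cont(1) u'c _ t, of 1 x] s u'x[OF t, of x]
      by (simp add: add.assoc)
    show "((\<lambda>s. \<rho> s x) has_real_derivative k3 * (u t x * deriv (\<rho> t) x + deriv (u t) x * \<rho> t x)) (at t within {0..})"
      using sobolev_C1_time_derivative[OF C1(2) cont(2) \<rho>'c _ t, of 0 x] s \<rho>'[OF t] by simp
    show "(u t \<longlongrightarrow> 0) at_infinity"
      using sobolev_tendsto_0[OF us[OF t] cont(1)[OF t]] s by simp
    then show "(deriv (u t) \<longlongrightarrow> 0) at_infinity"
    proof (rule tendsto_0_derivative[OF _ ux[OF t] uxx[OF t]])
      show "\<bar>deriv (deriv (u t)) x\<bar> \<le> embedding_const 2 s * sobolev_norm s (u t)" for x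
        using sobolev_deriv(1)[OF us[OF t] cont(1)[OF t], of 2 x] s by (simp add: numeral_2_eq_2)
    qed
    show "(\<rho> t \<longlongrightarrow> 0) at_infinity"
      using sobolev_tendsto_0[OF \<rho>s[OF t] cont(2)[OF t]] s by simp
    show "(p t \<longlongrightarrow> 0) at_infinity"
      using sobolev_tendsto_0[OF ps[OF t] pc[OF t]] s by simp
  next
    show "sup_continuous u" "sup_continuous (\<lambda>t. deriv (u t))" "sup_continuous \<rho>"
      using sobolev_C0_sup_continuous[OF C0(1) cont(1), of 0] sobolev_C0_sup_continuous[OF C0(1) cont(1), of 1]
        sobolev_C0_sup_continuous[OF C0(2) cont(2), of 0] s by simp_all
  next
    fix \<tau> :: real
    obtain M0 where M0: "\<And>t x. 0 \<le> t \<Longrightarrow> t \<le> \<tau> \<Longrightarrow> \<bar>(deriv ^^ 0) (u t) x\<bar> \<le> M0"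
      using sobolev_C0_bounded[OF C0(1) cont(1), of 0 \<tau>] s by auto
    obtain M1 where M1: "\<And>t x. 0 \<le> t \<Longrightarrow> t \<le> \<tau> \<Longrightarrow> \<bar>(deriv ^^ 1) (u t) x\<bar> \<le> M1"
      using sobolev_C0_bounded[OF C0(1) cont(1), of 1 \<tau>] s by auto
    obtain M2 where M2: "\<And>t x. 0 \<le> t \<Longrightarrow> t \<le> \<tau> \<Longrightarrow> \<bar>(deriv ^^ 2) (u t) x\<bar> \<le> M2"
      using sobolev_C0_bounded[OF C0(1) cont(1), of 2 \<tau>] s by auto
    obtain N0 where N0: "\<And>t x. 0 \<le> t \<Longrightarrow> t \<le> \<tau> \<Longrightarrow> \<bar>(deriv ^^ 0) (\<rho> t) x\<bar> \<le> N0"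
      using sobolev_C0_bounded[OF C0(2) cont(2), of 0 \<tau>] s by auto
    obtain N1 where N1: "\<And>t x. 0 \<le> t \<Longrightarrow> t \<le> \<tau> \<Longrightarrow> \<bar>(deriv ^^ 1) (\<rho> t) x\<bar> \<le> N1"
      using sobolev_C0_bounded[OF C0(2) cont(2), of 1 \<tau>] s by auto
    show "\<exists>M. \<forall>t x. 0 \<le> t \<longrightarrow> t \<le> \<tau> \<longrightarrow> \<bar>u t x\<bar> \<le> M \<and> \<bar>deriv (u t) x\<bar> \<le> M \<and>
        \<bar>deriv (deriv (u t)) x\<bar> \<le> M \<and> \<bar>\<rho> t x\<bar> \<le> M \<and> \<bar>deriv (\<rho> t) x\<bar> \<le> M"
    proof (intro exI allI impI)
      fix t x assume t: "0 \<le> t" "t \<le> \<tau>"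
      show "\<bar>u t x\<bar> \<le> Max {M0, M1, M2, N0, N1} \<and> \<bar>deriv (u t) x\<bar> \<le> Max {M0, M1, M2, N0, N1} \<and>
        \<bar>deriv (deriv (u t)) x\<bar> \<le> Max {M0, M1, M2, N0, N1} \<and> \<bar>\<rho> t x\<bar> \<le> Max {M0, M1, M2, N0, N1} \<and>
        \<bar>deriv (\<rho> t) x\<bar> \<le> Max {M0, M1, M2, N0, N1}"
        using M0[OF t, of x] M1[OF t, of x] M2[OF t, of x] N0[OF t, of x] N1[OF t, of x]
        by (auto simp: numeral_2_eq_2 le_max_iff_disj)
    qed
  qed
  then show ?thesis by blast
qed

theorem theorem4p2:
  fixes b k1 k2 k3 s :: real
    and u0 \<rho>0 :: "real \<Rightarrow> real"
    and T :: ereal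
    and u \<rho> :: "real \<Rightarrow> real \<Rightarrow> real"
  assumes "(k1 = b \<and> k2 = 2 * b \<and> k3 = 1) \<or> (k1 = b + 1 \<and> k2 = 2 \<and> k3 = b)"
    and "s > 5 / 2"
    and "u0 \<in> sobolev s" and "continuous_on UNIV u0"
    and "\<rho>0 \<in> sobolev (s - 1)" and "continuous_on UNIV \<rho>0"
    and "b_family_maximal_solution k1 k2 k3 s u0 \<rho>0 T u \<rho>"
    and "1 < k1" and "k1 \<le> 3" and "k2 \<ge> 0"
    and "\<And>x. u0 (- x) = - u0 x"
    and "\<And>x. \<rho>0 (- x) = \<rho>0 x"
    and "\<rho>0 0 = 0"
    and "deriv u0 0 = 0"
    and "u0 \<noteq> (\<lambda>x. 0) \<or> \<rho>0 \<noteq> (\<lambda>x. 0)"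
  shows "T < \<infinity>"
proof (rule ccontr)
  assume "\<not> T < \<infinity>"
  then have "T = \<infinity>" by simp
  then have sol: "b_family_solution k1 k2 k3 s u0 \<rho>0 \<infinity> u \<rho>"
    using assms(7) by (simp add: b_family_maximal_solution_def)
  then have init: "u 0 = u0" "\<rho> 0 = \<rho>0"
    by (auto simp: b_family_solution_def)
  obtain p where "classical_b_family k1 k2 k3 u (\<lambda>t. deriv (u t)) (\<lambda>t. deriv (deriv (u t))) \<rho>
    (\<lambda>t. deriv (\<rho> t)) p (\<lambda>t. deriv (p t))"
    using global_solution_classical[OF assms(2) sol] by blast
  then interpret classical_b_family k1 k2 k3 u "\<lambda>t. deriv (u t)" "\<lambda>t. deriv (deriv (u t))" \<rho>
    "\<lambda>t. deriv (\<rho> t)" p "\<lambda>t. deriv (p t)"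
    "\<lambda>t x. k1 / 2 * (u t x)\<^sup>2 + (3 - k1) / 2 * (deriv (u t) x)\<^sup>2 + k2 / 2 * (\<rho> t x)\<^sup>2" .
  \<comment> \<open>In the first case \<open>k2 = 2 * k1 > 0\<close>, in the second \<open>k2 = 2\<close>.\<close>
  have "k2 > 0" using assms(1,8) by auto
  then show False
    by (rule no_global_symmetric_solution[OF assms(8,9)]) (use assms init in auto)
qed

end
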